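(* Let $d\ge1$. For each of the two models $M\in\{\text{sandpile},\text{double router}\}$ on $\mathbb{Z}^d$, let $\mathcal{V}_n=\mathcal{V}_{n,M,h}$ be the particle cluster of the model with background height $h$ started with $n$ particles at the origin. Then $$\lim_{h\to-\infty}\ \limsup_{n\to\infty}\ \lambda\left(\left(\tfrac{n}{|h|}\right)^{-1/d}\mathcal{V}_n\,\bigtriangleup\, B\right)=0,$$ where $\lambda$ is $d$-dimensional Lebesgue measure, $\bigtriangleup$ is symmetric difference, and $B$ is the Euclidean ball of unit volume centered at the origin in $\mathbb{R}^d$.
   Context: Fix an enumeration $\mathbf e_0,\dots,\mathbf e_{2d-1}$ of the $2d$ unit vectors $\pm$(coordinate vectors). A configuration consists of a particle function $H:\mathbb{Z}^d\to\mathbb{Z}$, a toppling function $T:\mathbb{Z}^d\to\mathbb{Z}$ and a direction function $D:\mathbb{Z}^d\to\{0,\dots,2d-1\}$. Each model has a constant $c$: $c=2$ for the double router model and $c=2d$ for the sandpile model. With background height $h\in\mathbb{Z}$, $h<c-1$, the initial configuration is $H_0(\mathbf 0)=n$, $H_0(\mathbf x)=h$ for $\mathbf x\neq\mathbf 0$, $T_0\equiv0$, $D_0$ arbitrary. A toppling of $\mathbf x$: $T(\mathbf x)$ increases by $1$; $H(\mathbf x)$ decreases by $c$; $H(\mathbf x+\mathbf e_i)$ increases by $1$ for $i=(D(\mathbf x)+1)\bmod 2d,\dots,(D(\mathbf x)+c)\bmod 2d$; then $D(\mathbf x)$ is replaced by $(D(\mathbf x)+c)\bmod 2d$. A toppling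 is legal if $H(\mathbf x)\ge0$ after it; a site is stable if $H(\mathbf x)\le c-1$. Performing legal topplings until all sites are stable takes finitely many topplings, and the final configuration $(H_n,T_n,D_n)$ does not depend on their order. For $\mathbf x\in\mathbb{Z}^d$ let $\mathbf x^\square=\mathbf x+[-\frac12,\frac12]^d$. The toppling cluster is $\mathcal{T}_n=\bigcup_{\mathbf x:T_n(\mathbf x)>0}\mathbf x^\square$ and the particle cluster is $\mathcal{V}_n=\mathcal{T}_n\cup\bigcup_{\mathbf x:H_n(\mathbf x)>h}\mathbf x^\square$. *)

theory Defs
  imports "HOL-Analysis.Analysis"
begin

datatype model = Sandpile | Double_Router

text \<open>The constant \<open>c\<close> of the model in dimension \<open>d\<close>.\<close>

fun model_const :: "model \<Rightarrow> nat \<Rightarrow> nat" where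
  "model_const Sandpile d = 2 * d"
| "model_const Double_Router d = 2"

text \<open>The lattice \<open>\<int>\<^sup>d\<close> is \<^typ>\<open>int ^ 'd\<close> with \<open>d = CARD('d)\<close>; directions are the indices
  \<open>0, \<dots>, 2d - 1\<close>.\<close>

record ('d::finite) config =
  particles :: "int ^ 'd \<Rightarrow> int"
  topplings :: "int ^ 'd \<Rightarrow> int"
  direction :: "int ^ 'd \<Rightarrow> nat"

definition unit_vector_enum :: "(nat \<Rightarrow> int ^ 'd::finite) \<Rightarrow> bool" where
  "unit_vector_enum e \<longleftrightarrow>
     bij_betw e {..<2 * CARD('d)} (range (\<lambda>i. axis i 1) \<union> range (\<lambda>i. axis i (-1)))"

definition initial_config ::
    "int \<Rightarrow> nat \<Rightarrow> (int ^ 'd::finite \<Rightarrow> nat) \<Rightarrow> 'd config" where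
  "initial_config h n D0 =
     \<lparr> particles = (\<lambda>x. if x = 0 then int n else h),
       topplings = (\<lambda>x. 0),
       direction = D0 \<rparr>"

definition topple ::
    "nat \<Rightarrow> (nat \<Rightarrow> int ^ 'd::finite) \<Rightarrow> int ^ 'd \<Rightarrow> 'd config \<Rightarrow> 'd config" where
  "topple c e x s =
     \<lparr> particles = (\<lambda>y. particles s y - (if y = x then int c else 0)
          + int (card {k \<in> {1..c}. y = x + e ((direction s x + k) mod (2 * CARD('d)))})),
       topplings = (topplings s)(x := topplings s x + 1),
       direction = (direction s)(x := (direction s x + c) mod (2 * CARD('d))) \<rparr>"

definition legal_topple ::
    "nat \<Rightarrow> (nat \<Rightarrow> int ^ 'd::finite) \<Rightarrow> 'd config \<Rightarrow> 'd config \<Rightarrow> bool" where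
  "legal_topple c e s s' \<longleftrightarrow> (\<exists>x. s' = topple c e x s \<and> particles s' x \<ge> 0)"

definition stable :: "nat \<Rightarrow> 'd::finite config \<Rightarrow> bool" where
  "stable c s \<longleftrightarrow> (\<forall>x. particles s x \<le> int c - 1)"

text \<open>The definite description is meaningful because stabilization is finite and does not depend
  on the order of the topplings.\<close>

definition final_config ::
    "nat \<Rightarrow> (nat \<Rightarrow> int ^ 'd::finite) \<Rightarrow> int \<Rightarrow> nat \<Rightarrow> (int ^ 'd \<Rightarrow> nat) \<Rightarrow> 'd config" where
  "final_config c e h n D0 =
     (THE s. (legal_topple c e)\<^sup>*\<^sup>* (initial_config h n D0) s \<and> stable c s)"

definition unit_cube :: "int ^ 'd::finite \<Rightarrow> (real ^ 'd) set" where
  "unit_cube x = (+) (\<chi> i. real_of_int (x $ i)) ` cbox (\<chi> i. - (1/2)) (\<chi> i. 1/2)"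

definition toppling_cluster ::
    "nat \<Rightarrow> (nat \<Rightarrow> int ^ 'd::finite) \<Rightarrow> int \<Rightarrow> nat \<Rightarrow> (int ^ 'd \<Rightarrow> nat) \<Rightarrow> (real ^ 'd) set" where
  "toppling_cluster c e h n D0 =
     (\<Union>x \<in> {x. topplings (final_config c e h n D0) x > 0}. unit_cube x)"

definition particle_cluster ::
    "nat \<Rightarrow> (nat \<Rightarrow> int ^ 'd::finite) \<Rightarrow> int \<Rightarrow> nat \<Rightarrow> (int ^ 'd \<Rightarrow> nat) \<Rightarrow> (real ^ 'd) set" where
  "particle_cluster c e h n D0 =
     toppling_cluster c e h n D0 \<union>
     (\<Union>x \<in> {x. particles (final_config c e h n D0) x > h}. unit_cube x)"

end

theory Submission
  imports Defs
begin

text \<open>Only an inner bound is needed. Write \<open>m = \<bar>h\<bar>\<close> and \<open>u = c T\<close>. Stability makes the averaging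
  Laplacian of \<open>u\<close> at most \<open>m + 4d - n \<delta>\<^sub>0\<close>, the \<open>O(d)\<close> term absorbing the rounding in the
  router rule. Summing \<open>u\<close> over translates in a ball of fixed radius \<open>K + 1\<close> replaces the point source by a
  spread-out one; comparison with the radial profile \<open>\<psi>(\<bar>x\<bar>\<^sup>2)\<close>, an explicit truncated fundamental
  solution, then shows that this sum tends to infinity with \<open>n\<close>, uniformly on a ball of volume nearly
  \<open>n / m\<close>. Since \<open>u\<close> grows at most by a bounded factor along each edge, \<open>u\<close> itself is positive there.
  Hence the set \<open>A\<close> of toppled sites contains almost the whole ball \<open>B\<close>; each site of \<open>A\<close> holds at
  least \<open>m\<close> particles above the background, so \<open>A\<close> has at most \<open>(n + m) / m\<close> sites and only few lie outside
  \<open>B\<close>. Every untoppled site of the cluster is a neighbour of \<open>A\<close>, so few of those lie outside either.\<close>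

section \<open>The lattice Laplacian\<close>

text \<open>The explicit \<psi> has one-sided estimates only: its Laplacian is at least 0 far out
  and at least \<open>- 2 d p0\<close> everywhere. Summing u over translates in the ball
  \<open>Q\<close> of radius K + 1 puts a source n at every point of \<open>Q\<close>, which matches
  the latter bound pointwise. The price is that \<open>p0 * card Q\<close> may exceed its continuum
  value r^(-d); the bound on the ratio tends to 1 as K grows, and K is fixed before n. The
  comparison function is \<psi>(t) + \<kappa> t with t = |x|^2, where \<kappa> is the value of
  \<open>profile\<close> at the squared outer radius t1. This is the radial obstacle problem: after
  subtracting a constant, value and gradient vanish together at the free boundary. Well inside, the
  function gains at least a multiple of \<kappa> t1, while overshooting the boundary by one lattice
  step costs order \<kappa> sqrt t1. Since n \<kappa> does not depend on n, n times the difference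
  tends to infinity. Around a zero of u there is a bound free of n, so zeros are excluded. All
  losses are charged to one parameter \<eta> < 1, chosen before h, which is chosen before n.\<close>

definition units :: "(int ^ 'd::finite) set" where
  "units = range (\<lambda>i. axis i 1) \<union> range (\<lambda>i. axis i (-1))"

definition lap :: "(int ^ 'd::finite \<Rightarrow> real) \<Rightarrow> int ^ 'd \<Rightarrow> real" where
  "lap u x = (\<Sum>v\<in>units. u (x + v) - u x)"

definition l1 :: "int ^ 'd::finite \<Rightarrow> nat" where
  "l1 x = (\<Sum>i\<in>UNIV. nat \<bar>x $ i\<bar>)"

lemma finite_units [simp]: "finite (units :: (int ^ 'd::finite) set)"
  by (simp add: units_def)

lemma uminus_axis: "- axis i (a::int) = axis i (-a)"
  by (simp add: axis_def vec_eq_iff)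

lemma uminus_units: "uminus ` (units :: (int ^ 'd::finite) set) = units"
  by (simp add: units_def image_Un image_image uminus_axis Un_commute)

lemma sum_units:
  "(\<Sum>v\<in>(units :: (int ^ 'd::finite) set). F v) = (\<Sum>i\<in>UNIV. F (axis i 1) + F (axis i (-1)) :: real)"
proof -
  have inj: "inj (\<lambda>i. axis i a :: int ^ 'd)" if "a \<noteq> 0" for a
    using that by (auto simp: inj_def axis_eq_axis)
  have "range (\<lambda>i. axis i 1 :: int ^ 'd) \<inter> range (\<lambda>i. axis i (-1)) = {}"
    by (auto simp: axis_eq_axis)
  then have "(\<Sum>v\<in>(units :: (int ^ 'd) set). F v)
      = (\<Sum>v\<in>range (\<lambda>i. axis i 1). F v) + (\<Sum>v\<in>range (\<lambda>i. axis i (-1)). F v)"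
    unfolding units_def by (intro sum.union_disjoint) auto
  also have "\<dots> = (\<Sum>i\<in>UNIV. F (axis i 1)) + (\<Sum>i\<in>UNIV. F (axis i (-1)))"
    using inj[of 1] inj[of "-1"] by (simp add: sum.reindex)
  finally show ?thesis by (simp add: sum.distrib)
qed

lemma card_units: "card (units :: (int ^ 'd::finite) set) = 2 * CARD('d)"
proof -
  have "real (card (units :: (int ^ 'd) set)) = (\<Sum>v\<in>(units :: (int ^ 'd) set). 1)" by simp
  also have "\<dots> = 2 * CARD('d)" by (subst sum_units) simp
  finally show ?thesis using of_nat_eq_iff by fastforce
qed

lemma lap_alt: "lap u x = (\<Sum>v\<in>units. u (x + v)) - 2 * real CARD('d) * u (x :: int ^ 'd::finite)"
  by (simp add: lap_def sum_subtractf card_units)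

lemma sum_units_uminus:
  "(\<Sum>v\<in>units. F (x - v)) = (\<Sum>v\<in>(units :: (int ^ 'd::finite) set). F (x + v) :: real)"
proof -
  have "(\<Sum>v\<in>uminus ` (units :: (int ^ 'd) set). F (x + v)) = (\<Sum>v\<in>units. F (x - v))"
    by (subst sum.reindex) (auto simp: inj_on_def)
  then show ?thesis by (simp add: uminus_units)
qed

lemma unit_nonzero: "v \<in> units \<Longrightarrow> v \<noteq> 0"
  by (auto simp: units_def)

lemma uminus_in_units: "v \<in> units \<Longrightarrow> - v \<in> units"
  using uminus_units by blast

lemma l1_axis: "l1 (axis i a :: int ^ 'd::finite) = nat \<bar>a\<bar>"
proof -
  have "l1 (axis i a :: int ^ 'd) = (\<Sum>j\<in>UNIV. if j = i then nat \<bar>a\<bar> else 0)"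
    unfolding l1_def by (intro sum.cong) (auto simp: axis_def)
  then show ?thesis by simp
qed

lemma l1_unit: "v \<in> units \<Longrightarrow> l1 v = 1"
  by (auto simp: units_def l1_axis)

lemma l1_triangle: "l1 (x + y) \<le> l1 x + l1 y"
  by (auto simp: l1_def sum.distrib[symmetric] intro!: sum_mono)

lemma l1_minus: "l1 (- x) = l1 x"
  by (simp add: l1_def)

lemma l1_zero [simp]: "l1 0 = 0"
  by (simp add: l1_def)

lemma l1_eq_0: "l1 x = 0 \<longleftrightarrow> x = 0"
  by (auto simp: l1_def vec_eq_iff)

lemma finite_coord_bounded: "finite {x :: int ^ 'd::finite. \<forall>i. \<bar>x $ i\<bar> \<le> L}"
proof -
  have "finite (PiE (UNIV :: 'd set) (\<lambda>_. {-L..L}))"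
    by (intro finite_PiE) auto
  moreover have "{x :: int ^ 'd. \<forall>i. \<bar>x $ i\<bar> \<le> L} \<subseteq> vec_lambda ` (PiE (UNIV :: 'd set) (\<lambda>_. {-L..L}))"
  proof
    fix x :: "int ^ 'd" assume "x \<in> {x. \<forall>i. \<bar>x $ i\<bar> \<le> L}"
    then have "vec_nth x \<in> PiE (UNIV :: 'd set) (\<lambda>_. {-L..L})"
      by (auto simp: abs_le_iff PiE_def) (use minus_le_iff in blast)
    then have "vec_lambda (vec_nth x) \<in> vec_lambda ` (PiE (UNIV :: 'd set) (\<lambda>_. {-L..L}))"
      by blast
    then show "x \<in> vec_lambda ` (PiE (UNIV :: 'd set) (\<lambda>_. {-L..L}))"
      by simp
  qed
  ultimately show ?thesis using finite_subset by blast
qed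

lemma finite_l1_le: "finite {x :: int ^ 'd::finite. l1 x \<le> L}"
proof (rule finite_subset[OF _ finite_coord_bounded[of "int L"]], safe)
  fix x :: "int ^ 'd" and i assume "l1 x \<le> L"
  moreover have "nat \<bar>x $ i\<bar> \<le> l1 x" unfolding l1_def by (rule member_le_sum) auto
  ultimately show "\<bar>x $ i\<bar> \<le> int L" by linarith
qed

text \<open>One step along the sign of a nonzero coordinate. This supplies the shortest lattice
  paths along which \<open>crude_harnack\<close> inducts.\<close>

lemma l1_step:
  fixes y :: "int ^ 'd::finite"
  assumes "l1 y = Suc k"
  obtains v where "v \<in> units" "l1 (y - v) = k"
proof -
  from assms have "y \<noteq> 0" by auto
  then obtain i where i: "y $ i \<noteq> 0" by (auto simp: vec_eq_iff)
  define v where "v = (axis i (sgn (y $ i)) :: int ^ 'd)"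
  have "v \<in> units" using i by (auto simp: v_def units_def sgn_if)
  have "l1 y = nat \<bar>y $ i\<bar> + (\<Sum>j\<in>UNIV - {i}. nat \<bar>y $ j\<bar>)"
    unfolding l1_def by (subst sum.remove[of _ i]) auto
  moreover have "l1 (y - v) = nat \<bar>(y - v) $ i\<bar> + (\<Sum>j\<in>UNIV - {i}. nat \<bar>(y - v) $ j\<bar>)"
    unfolding l1_def by (subst sum.remove[of _ i]) auto
  moreover have "(\<Sum>j\<in>UNIV - {i}. nat \<bar>(y - v) $ j\<bar>) = (\<Sum>j\<in>UNIV - {i}. nat \<bar>y $ j\<bar>)"
    by (intro sum.cong) (auto simp: v_def axis_def)
  moreover have "nat \<bar>y $ i\<bar> = Suc (nat \<bar>(y - v) $ i\<bar>)"
    using i by (auto simp: v_def sgn_if)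
  ultimately have "l1 (y - v) = k" using assms by linarith
  with \<open>v \<in> units\<close> show ?thesis using that by blast
qed

section \<open>Growth of nonnegative functions whose Laplacian is bounded above\<close>

fun harnack_bound :: "real \<Rightarrow> real \<Rightarrow> nat \<Rightarrow> real" where
  "harnack_bound D a 0 = 0"
| "harnack_bound D a (Suc k) = D * (harnack_bound D a k + a)"

lemma harnack_bound_mono:
  assumes "D \<ge> 1" "a \<ge> 0" "k \<le> l"
  shows "0 \<le> harnack_bound D a k \<and> harnack_bound D a k \<le> harnack_bound D a l"
proof -
  have pos: "0 \<le> harnack_bound D a k" for k using assms by (induction k) auto
  have step: "harnack_bound D a k \<le> harnack_bound D a (Suc k)" for k
  proof -
    have "1 * (harnack_bound D a k + a) \<le> D * (harnack_bound D a k + a)"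
      using assms pos[of k] by (intro mult_right_mono) auto
    then show ?thesis using assms by simp
  qed
  from lift_Suc_mono_le[of "harnack_bound D a", OF step assms(3)] pos show ?thesis by blast
qed

text \<open>By nonnegativity one neighbour is at most the sum of all neighbours, which the Laplacian
  bound turns into 2d (u + a). It serves twice: to bound the toppling counts during stabilization,
  and to turn a large local sum of u into positivity of u.\<close>

lemma crude_harnack:
  fixes u :: "int ^ 'd::finite \<Rightarrow> real"
  assumes nonneg: "\<And>x. u x \<ge> 0"
    and lap: "\<And>x. lap u x \<le> 2 * real CARD('d) * a"
    and zero: "u x = 0"
  shows "u (x + y) \<le> harnack_bound (2 * real CARD('d)) a (l1 y)"
proof (induction "l1 y" arbitrary: y)
  case 0
  then show ?case using zero by (simp add: l1_eq_0[of y])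
next
  case (Suc k)
  from Suc.hyps(2)[symmetric] obtain v where v: "v \<in> units" "l1 (y - v) = k"
    by (rule l1_step)
  have "u (x + y) = u (x + (y - v) + v)" by simp
  also have "\<dots> \<le> (\<Sum>w\<in>units. u (x + (y - v) + w))"
    using v nonneg by (intro member_le_sum) auto
  also have "\<dots> \<le> 2 * real CARD('d) * (u (x + (y - v)) + a)"
    using lap[of "x + (y - v)"] by (simp add: lap_alt algebra_simps)
  also have "\<dots> \<le> 2 * real CARD('d) * (harnack_bound (2 * real CARD('d)) a k + a)"
    using Suc.hyps(1)[of "y - v"] v by (intro mult_left_mono) auto
  finally show ?case using Suc.hyps(2)[symmetric] by simp
qed

section \<open>Stabilization\<close>

text \<open>Of L particles emitted one by one from a site with initial pointer D, this many leave in
  direction j when p = 2d. Grouping the emissions into topplings of size c is then irrelevant, so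
  both models are treated alike.\<close>

definition visits :: "nat \<Rightarrow> nat \<Rightarrow> nat \<Rightarrow> nat \<Rightarrow> nat" where
  "visits p D L j = card {k \<in> {1..L}. (D + k) mod p = j}"

lemma visits_0 [simp]: "visits p D 0 j = 0"
  by (simp add: visits_def)

text \<open>After L emissions the pointer stands at \<open>(D + L) mod p\<close>, the value that
  \<open>topple\<close> stores, so successive topplings concatenate.\<close>

lemma visits_add: "visits p D (L + c) j = visits p D L j + card {k \<in> {1..c}. ((D + L) mod p + k) mod p = j}"
proof -
  have "{k \<in> {1..L + c}. (D + k) mod p = j} =
      {k \<in> {1..L}. (D + k) mod p = j} \<union> (+) L ` {k \<in> {1..c}. (D + L + k) mod p = j}"
  proof (intro set_eqI iffI)
    fix k assume k: "k \<in> {k \<in> {1..L + c}. (D + k) mod p = j}"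
    show "k \<in> {k \<in> {1..L}. (D + k) mod p = j} \<union> (+) L ` {k \<in> {1..c}. (D + L + k) mod p = j}"
    proof (cases "k \<le> L")
      case False
      then have "k = L + (k - L)" "k - L \<in> {k \<in> {1..c}. (D + L + k) mod p = j}" using k by auto
      then show ?thesis by blast
    qed (use k in auto)
  qed (auto simp: add.assoc)
  moreover have "{k \<in> {1..L}. (D + k) mod p = j} \<inter> (+) L ` {k \<in> {1..c}. (D + L + k) mod p = j} = {}"
    by auto
  ultimately have "visits p D (L + c) j =
      card {k \<in> {1..L}. (D + k) mod p = j} + card ((+) L ` {k \<in> {1..c}. (D + L + k) mod p = j})"
    unfolding visits_def by (simp add: card_Un_disjoint)
  then show ?thesis by (simp add: visits_def card_image mod_add_left_eq)
qed

lemma visits_mono: "L \<le> L' \<Longrightarrow> visits p D L j \<le> visits p D L' j"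
  by (metis visits_add le_add1 le_Suc_ex)

lemma visits_period:
  assumes "j < p"
  shows "visits p D p j \<ge> 1"
proof -
  \<comment> \<open>The first emission in direction j. If j equals \<open>D mod p\<close>, a full
    turn k = p is required, because the pointer advances before it emits.\<close>
  define k where "k = (if j \<le> D mod p then j + p - D mod p else j - D mod p)"
  have Dp: "D mod p < p" using assms by simp
  have k: "k \<in> {1..p}" 
  proof (cases "j \<le> D mod p")
    case True
    then have "k = j + p - D mod p" by (simp add: k_def)
    then have "1 \<le> k" "k \<le> p" using True Dp by linarith+
    then show ?thesis by simp
  next
    case False
    then have "k = j - D mod p" by (simp add: k_def)
    then have "1 \<le> k" "k \<le> p" using False assms by linarith+
    then show ?thesis by simp
  qed
  have "(D + k) mod p = (D mod p + k) mod p" by (simp add: mod_add_left_eq)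
  also have "D mod p + k = (if j \<le> D mod p then j + p else j)" using Dp by (auto simp: k_def)
  also have "(if j \<le> D mod p then j + p else j) mod p = j" using assms by auto
  finally have "{k} \<subseteq> {k \<in> {1..p}. (D + k) mod p = j}" using k by auto
  then have "card {k} \<le> card {k \<in> {1..p}. (D + k) mod p = j}" by (intro card_mono) auto
  then show ?thesis by (simp add: visits_def)
qed

text \<open>Each of the \<open>L div p\<close> complete turns visits j at least once. The loss of 1
  is the whole rounding error per direction, whatever the initial pointer.\<close>

lemma visits_lower:
  assumes "j < p"
  shows "real (visits p D L j) \<ge> real L / real p - 1"
proof -
  have "visits p D (q * p) j \<ge> q" for q
  proof (induction q)
    case (Suc q)
    have "visits p D (q * p + p) j = visits p D (q * p) j + visits p ((D + q * p) mod p) p j"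
      by (subst visits_add) (simp add: visits_def)
    then show ?case using Suc visits_period[OF assms, of "(D + q * p) mod p"] by (simp add: add.commute)
  qed simp
  from this[of "L div p"] visits_mono[of "L div p * p" L p D j]
  have *: "L div p \<le> visits p D L j" by (simp add: order_trans)
  have "real L / real p < real (L div p) + 1"
    using floor_correct[of "real L / real p"] by (simp add: floor_divide_of_nat_eq)
  moreover have "real (L div p) \<le> real (visits p D L j)" using * by simp
  ultimately show ?thesis by linarith
qed

text \<open>A reachable configuration is determined by the number \<open>t\<close> of topplings of each site.\<close>

definition conf ::
    "nat \<Rightarrow> (nat \<Rightarrow> int ^ 'd::finite) \<Rightarrow> int \<Rightarrow> nat \<Rightarrow> (int ^ 'd \<Rightarrow> nat) \<Rightarrow> (int ^ 'd \<Rightarrow> nat) \<Rightarrow> 'd config" where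
  "conf c e h n D t =
     \<lparr> particles = (\<lambda>x. (if x = 0 then int n else h) - int (c * t x)
          + (\<Sum>j<2 * CARD('d). int (visits (2 * CARD('d)) (D (x - e j)) (c * t (x - e j)) j))),
       topplings = (\<lambda>x. int (t x)),
       direction = (\<lambda>x. (D x + c * t x) mod (2 * CARD('d))) \<rparr>"

lemma conf_initial:
  fixes D :: "int ^ 'd::finite \<Rightarrow> nat"
  assumes "\<And>x. D x < 2 * CARD('d)"
  shows "initial_config h n D = conf c e h n D (\<lambda>_. 0)"
  using assms by (auto simp: initial_config_def conf_def)

text \<open>A particle that x sends to y in direction j is counted at y in the summand with
  \<open>y - e j = x\<close>. Hence a toppling only increments one count, and the order of topplings
  leaves no trace in the state.\<close>

lemma topple_conf:
  fixes D :: "int ^ 'd::finite \<Rightarrow> nat"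
  shows "topple c e x (conf c e h n D t) = conf c e h n D (t(x := Suc (t x)))"
proof -
  let ?p = "2 * CARD('d)"
  let ?t = "t(x := Suc (t x))"
  let ?g = "\<lambda>k. ((D x + c * t x) mod ?p + k) mod ?p"
  have key: "(\<Sum>j<?p. int (visits ?p (D (y - e j)) (c * ?t (y - e j)) j)) =
      (\<Sum>j<?p. int (visits ?p (D (y - e j)) (c * t (y - e j)) j)) +
      int (card {k \<in> {1..c}. y = x + e (?g k)})" for y
  proof -
    have "int (card {k \<in> {1..c}. y = x + e (?g k)}) =
        (\<Sum>k\<in>{1..c}. if y = x + e (?g k) then 1 else 0)"
      by (simp add: sum.If_cases Int_def conj_commute)
    also have "\<dots> = (\<Sum>k\<in>{1..c}. \<Sum>j<?p. if y - e j = x \<and> ?g k = j then 1 else 0)"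
    proof (intro sum.cong refl)
      fix k
      have "?g k < ?p" by simp
      have "(\<Sum>j<?p. if y - e j = x \<and> ?g k = j then 1 else 0) =
          (\<Sum>j<?p. if j = ?g k then (if y - e (?g k) = x then 1 else 0) else 0 :: int)"
        by (intro sum.cong) auto
      also have "\<dots> = (if y - e (?g k) = x then 1 else 0)"
        using \<open>?g k < ?p\<close> by (subst sum.delta) auto
      finally show "(if y = x + e (?g k) then 1 else 0) =
          (\<Sum>j<?p. if y - e j = x \<and> ?g k = j then 1 else 0 :: int)"
        by (auto simp: algebra_simps)
    qed
    also have "\<dots> = (\<Sum>j<?p. \<Sum>k\<in>{1..c}. if y - e j = x \<and> ?g k = j then 1 else 0)"
      by (rule sum.swap)
    also have "\<dots> = (\<Sum>j<?p. if y - e j = x then int (card {k \<in> {1..c}. ?g k = j}) else 0)"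
      by (intro sum.cong) (auto simp: sum.If_cases Int_def conj_commute)
    finally have "int (card {k \<in> {1..c}. y = x + e (?g k)}) =
        (\<Sum>j<?p. if y - e j = x then int (card {k \<in> {1..c}. ?g k = j}) else 0)" .
    moreover have "int (visits ?p (D (y - e j)) (c * ?t (y - e j)) j) =
       int (visits ?p (D (y - e j)) (c * t (y - e j)) j) +
       (if y - e j = x then int (card {k \<in> {1..c}. ?g k = j}) else 0)" for j
      using visits_add[of ?p "D x" "c * t x" c j] by (auto simp: add.commute)
    ultimately show ?thesis by (simp only: sum.distrib)
  qed
  have "particles (topple c e x (conf c e h n D t)) y = particles (conf c e h n D ?t) y" for y
  proof -
    have "- int (c * t y) - (if y = x then int c else 0) = - int (c * ?t y)"
      by (simp add: algebra_simps)
    then show ?thesis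
      unfolding topple_def conf_def config.select_convs key[of y] by linarith
  qed
  moreover have "((D x + c * t x) mod ?p + c) mod ?p = (D x + (c + c * t x)) mod ?p"
    by (metis mod_add_left_eq add.assoc add.commute)
  ultimately show ?thesis
    by (auto simp: topple_def conf_def fun_eq_iff)
qed

lemma enum_unit:
  fixes e :: "nat \<Rightarrow> int ^ 'd::finite"
  assumes "unit_vector_enum e" "j < 2 * CARD('d)"
  shows "e j \<in> units"
  using assms by (auto simp: unit_vector_enum_def units_def bij_betw_def)

lemma sum_enum:
  fixes e :: "nat \<Rightarrow> int ^ 'd::finite"
  assumes "unit_vector_enum e"
  shows "(\<Sum>j<2 * CARD('d). F (x - e j)) = (\<Sum>v\<in>units. F (x + v) :: real)"
proof -
  have "(\<Sum>j<2 * CARD('d). F (x - e j)) = (\<Sum>v\<in>units. F (x - v))"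
    using assms sum.reindex_bij_betw[of e "{..<2 * CARD('d)}" units "\<lambda>v. F (x - v)"]
    by (simp add: unit_vector_enum_def units_def)
  then show ?thesis by (simp add: sum_units_uminus)
qed

lemma particles_topple_self:
  fixes e :: "nat \<Rightarrow> int ^ 'd::finite"
  assumes "unit_vector_enum e"
  shows "particles (topple c e x s) x = particles s x - int c"
proof -
  have "e (k mod (2 * CARD('d))) \<noteq> 0" for k
    using enum_unit[OF assms, of "k mod (2 * CARD('d))"] unit_nonzero by auto
  then show ?thesis by (simp add: topple_def)
qed

text \<open>Each of the 2d neighbours sends at least its fair share \<open>c * t / 2d\<close> less
  1, so the incoming flow falls short of the average by at most 2d. This is the additive term; the
  outer factor 2d turns the average back into \<open>lap\<close>.\<close>

lemma lap_conf:
  fixes e :: "nat \<Rightarrow> int ^ 'd::finite"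
  assumes "unit_vector_enum e"
  shows "lap (\<lambda>x. real (c * t x)) x \<le> 2 * real CARD('d) *
    (real_of_int (particles (conf c e h n D t) x) - (if x = 0 then real n else real_of_int h) + 2 * real CARD('d))"
proof -
  let ?p = "2 * CARD('d)"
  have "(\<Sum>v\<in>units. real (c * t (x + v)) / real ?p - 1) =
      (\<Sum>j<?p. real (c * t (x - e j)) / real ?p - 1)"
    by (rule sum_enum[OF assms, symmetric])
  also have "\<dots> \<le> (\<Sum>j<?p. real (visits ?p (D (x - e j)) (c * t (x - e j)) j))"
    by (intro sum_mono visits_lower) auto
  also have "\<dots> = real_of_int (particles (conf c e h n D t) x)
      - (if x = 0 then real n else real_of_int h) + real (c * t x)"
    by (simp add: conf_def)
  finally have "(\<Sum>v\<in>units. real (c * t (x + v)) / real ?p - 1) \<le> \<dots>" .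
  then have "(\<Sum>v\<in>units. real (c * t (x + v))) / real ?p - real ?p \<le>
      real_of_int (particles (conf c e h n D t) x)
      - (if x = 0 then real n else real_of_int h) + real (c * t x)"
    by (simp add: sum_subtractf sum_divide_distrib card_units)
  then have "(\<Sum>v\<in>units. real (c * t (x + v))) / real ?p \<le>
      real_of_int (particles (conf c e h n D t) x)
      - (if x = 0 then real n else real_of_int h) + real (c * t x) + real ?p"
    by linarith
  then have "(\<Sum>v\<in>units. real (c * t (x + v))) \<le> (
      real_of_int (particles (conf c e h n D t) x)
      - (if x = 0 then real n else real_of_int h) + real (c * t x) + real ?p) * real ?p"
    by (subst (asm) pos_divide_le_eq) auto
  then show ?thesis unfolding lap_alt by (simp add: algebra_simps)
qed

text \<open>If no neighbour toppled, nothing arrived and the height is at most its initial value h.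
  The origin is excluded because it starts at n. The fact is used for the connectedness clause of
  \<open>admissible\<close> and for the untoppled rim of the particle cluster.\<close>

lemma received_imp_neighbour:
  fixes e :: "nat \<Rightarrow> int ^ 'd::finite"
  assumes "unit_vector_enum e" "particles (conf c e h n D t) x > h" "x \<noteq> 0"
  shows "\<exists>v\<in>units. t (x + v) > 0"
proof (rule ccontr)
  assume "\<not> ?thesis"
  then have *: "t (x + v) = 0" if "v \<in> units" for v using that by auto
  have "t (x - e j) = 0" if "j < 2 * CARD('d)" for j
    using *[OF uminus_in_units[OF enum_unit[OF assms(1) that]]] by simp
  then have "particles (conf c e h n D t) x = h - int (c * t x)"
    using \<open>x \<noteq> 0\<close> by (simp add: conf_def)
  moreover have "int (c * t x) \<ge> 0" by simp
  ultimately show False using assms(2) by linarith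
qed

section \<open>Reachable configurations and the abelian property\<close>

definition stabilizing ::
    "nat \<Rightarrow> (nat \<Rightarrow> int ^ 'd::finite) \<Rightarrow> int \<Rightarrow> nat \<Rightarrow> (int ^ 'd \<Rightarrow> nat) \<Rightarrow> (int ^ 'd \<Rightarrow> nat) \<Rightarrow> bool" where
  "stabilizing c e h n D t \<longleftrightarrow>
     (legal_topple c e)\<^sup>*\<^sup>* (initial_config h n D) (conf c e h n D t) \<and> stable c (conf c e h n D t)"

text \<open>No unit vector is 0, so a toppling lowers its own site by exactly c. Height at least 0
  afterwards therefore means height at least c before: legal topplings are exactly the topplings of
  unstable sites.\<close>

lemma legal_topple_conf:
  fixes e :: "nat \<Rightarrow> int ^ 'd::finite"
  assumes "unit_vector_enum e"
  shows "legal_topple c e (conf c e h n D t) s \<longleftrightarrow>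
    (\<exists>x. s = conf c e h n D (t(x := Suc (t x))) \<and> particles (conf c e h n D t) x \<ge> int c)"
  unfolding legal_topple_def
  by (metis topple_conf particles_topple_self[OF assms] diff_ge_0_iff_ge)

lemma reachable_induct [consumes 3, case_names zero step]:
  fixes e :: "nat \<Rightarrow> int ^ 'd::finite"
  assumes enum: "unit_vector_enum e" and D: "\<And>x. D x < 2 * CARD('d)"
    and reach: "(legal_topple c e)\<^sup>*\<^sup>* (initial_config h n D) s"
    and zero: "P (\<lambda>_. 0)"
    and step: "\<And>t x. (legal_topple c e)\<^sup>*\<^sup>* (initial_config h n D) (conf c e h n D t) \<Longrightarrow> P t \<Longrightarrow>
      particles (conf c e h n D t) x \<ge> int c \<Longrightarrow> P (t(x := Suc (t x)))"
  shows "\<exists>t. s = conf c e h n D t \<and> P t"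
  using reach
proof (induction rule: rtranclp_induct)
  case base
  then show ?case using zero conf_initial[of D h n c e] D by blast
next
  case (step s s')
  then obtain t where t: "s = conf c e h n D t" "P t" by blast
  with step.hyps(2) obtain x where
    "s' = conf c e h n D (t(x := Suc (t x)))" "particles (conf c e h n D t) x \<ge> int c"
    using legal_topple_conf[OF enum] by blast
  then show ?case using t step.hyps(1) assms(5) by blast
qed

lemma conf_inject: "conf c e h n D t = conf c e h n D t' \<longleftrightarrow> t = t'"
proof
  assume "conf c e h n D t = conf c e h n D t'"
  then have "topplings (conf c e h n D t) = topplings (conf c e h n D t')" by simp
  then show "t = t'" by (auto simp: conf_def fun_eq_iff)
qed simp

lemma reachable_prop:
  fixes e :: "nat \<Rightarrow> int ^ 'd::finite"
  assumes enum: "unit_vector_enum e" and D: "\<And>x. D x < 2 * CARD('d)"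
    and reach: "(legal_topple c e)\<^sup>*\<^sup>* (initial_config h n D) (conf c e h n D t)"
    and zero: "P (\<lambda>_. 0)"
    and step: "\<And>t x. (legal_topple c e)\<^sup>*\<^sup>* (initial_config h n D) (conf c e h n D t) \<Longrightarrow> P t \<Longrightarrow>
      particles (conf c e h n D t) x \<ge> int c \<Longrightarrow> P (t(x := Suc (t x)))"
  shows "P t"
proof -
  have "\<exists>t'. conf c e h n D t = conf c e h n D t' \<and> P t'"
    using enum D reach zero step by (rule reachable_induct)
  then show ?thesis by (simp add: conf_inject)
qed

text \<open>Suppose a legal toppling at x were the first to push t above t'. Just before it, t and
  t' agree at x and t is at most t' elsewhere, so x has lost equally many particles and received no
  more than in the stable state t'. Then x is not unstable. Applied in both directions this makes
  the stable state unique.\<close>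

lemma least_action:
  fixes e :: "nat \<Rightarrow> int ^ 'd::finite"
  assumes enum: "unit_vector_enum e" and D: "\<And>x. D x < 2 * CARD('d)"
    and reach: "(legal_topple c e)\<^sup>*\<^sup>* (initial_config h n D) (conf c e h n D t)"
    and stable: "stable c (conf c e h n D t')"
  shows "t \<le> t'"
  using enum D reach
proof (rule reachable_prop)
  fix t x assume t: "t \<le> t'" and x: "particles (conf c e h n D t) x \<ge> int c"
  have "t x \<noteq> t' x"
  proof
    assume "t x = t' x"
    have "particles (conf c e h n D t) x \<le> particles (conf c e h n D t') x"
      using t \<open>t x = t' x\<close>
      by (auto simp: conf_def le_fun_def intro!: sum_mono visits_mono mult_le_mono)
    also have "\<dots> \<le> int c - 1" using stable by (simp add: stable_def)
    finally show False using x by simp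
  qed
  then have "t x < t' x" using t by (simp add: le_fun_def order_neq_le_trans)
  then show "t(x := Suc (t x)) \<le> t'" using t by (auto simp: le_fun_def)
qed (simp add: le_fun_def)

section \<open>Conservation of mass and termination\<close>

lemma particles_topple_ge:
  "y \<noteq> x \<Longrightarrow> particles s y \<le> particles (topple c e x s) y"
  by (simp add: topple_def)

text \<open>The c particles lost at x are charged in full because x lies in F, while some of them
  may land outside F; hence only an inequality.\<close>

lemma sum_particles_topple:
  assumes "finite F" "x \<in> F"
  shows "(\<Sum>y\<in>F. particles (topple c e x s) y) \<le> (\<Sum>y\<in>F. particles s y)"
proof -
  let ?g = "\<lambda>k. e ((direction s x + k) mod (2 * CARD('a)))"
  have "(\<Sum>y\<in>F. int (card {k \<in> {1..c}. y = x + ?g k})) = (\<Sum>y\<in>F. \<Sum>k\<in>{1..c}. if y = x + ?g k then 1 else 0)"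
    by (intro sum.cong) (auto simp: sum.If_cases Int_def conj_commute)
  also have "\<dots> = (\<Sum>k\<in>{1..c}. \<Sum>y\<in>F. if y = x + ?g k then 1 else 0)"
    by (rule sum.swap)
  also have "\<dots> \<le> (\<Sum>k\<in>{1..c}. 1)"
    using assms by (intro sum_mono) simp
  finally have "(\<Sum>y\<in>F. int (card {k \<in> {1..c}. y = x + ?g k})) \<le> int c" by simp
  moreover have "(\<Sum>y\<in>F. if y = x then int c else 0) = int c" using assms by simp
  ultimately show ?thesis by (simp add: topple_def sum.distrib sum_subtractf)
qed

text \<open>The last clause is a weak connectedness of the toppled set; it bounds the extent of that set
  by its cardinality.\<close>

definition admissible ::
    "nat \<Rightarrow> (nat \<Rightarrow> int ^ 'd::finite) \<Rightarrow> int \<Rightarrow> nat \<Rightarrow> (int ^ 'd \<Rightarrow> nat) \<Rightarrow> (int ^ 'd \<Rightarrow> nat) \<Rightarrow> bool" where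
  "admissible c e h n D t \<longleftrightarrow>
     (\<forall>F. finite F \<longrightarrow> (\<Sum>x\<in>F. particles (conf c e h n D t) x - h) \<le> int n - h) \<and>
     (\<forall>x. particles (conf c e h n D t) x \<ge> h) \<and>
     (\<forall>x. t x > 0 \<longrightarrow> particles (conf c e h n D t) x \<ge> 0) \<and>
     (\<forall>x k. t x > 0 \<longrightarrow> k \<le> l1 x \<longrightarrow> (\<exists>y. t y > 0 \<and> l1 y = k))"

lemma reachable_admissible:
  fixes e :: "nat \<Rightarrow> int ^ 'd::finite"
  assumes enum: "unit_vector_enum e" and D: "\<And>x. D x < 2 * CARD('d)" and h: "h < 0"
    and reach: "(legal_topple c e)\<^sup>*\<^sup>* (initial_config h n D) (conf c e h n D t)"
  shows "admissible c e h n D t"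
  using enum D reach
proof (rule reachable_prop)
  have "(\<Sum>x\<in>F. (if x = 0 then int n else h) - h) \<le> int n - h" if "finite F" for F :: "(int ^ 'd) set"
  proof -
    have "(\<Sum>x\<in>F. (if x = 0 then int n else h) - h) = (\<Sum>x\<in>F. if x = 0 then int n - h else 0)"
      by (intro sum.cong) auto
    also have "\<dots> \<le> int n - h" using that h by simp
    finally show ?thesis .
  qed
  then show "admissible c e h n D (\<lambda>_. 0)"
    using h by (auto simp: admissible_def conf_def)
next
  fix t x assume adm: "admissible c e h n D t" and x: "particles (conf c e h n D t) x \<ge> int c"
  let ?H = "particles (conf c e h n D t)" and ?t = "t(x := Suc (t x))"
  let ?H' = "particles (conf c e h n D ?t)"
  have H': "?H' = particles (topple c e x (conf c e h n D t))" by (simp add: topple_conf)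
  have self: "?H' x \<ge> 0" using x by (simp add: H' particles_topple_self[OF enum])
  have other: "?H y \<le> ?H' y" if "y \<noteq> x" for y
    unfolding H' using that by (rule particles_topple_ge)
  have above: "?H y \<ge> h" and toppled: "t y > 0 \<Longrightarrow> ?H y \<ge> 0" for y
    using adm unfolding admissible_def by blast+
  have "(\<Sum>y\<in>F. ?H' y - h) \<le> int n - h" if F: "finite F" for F
  proof -
    \<comment> \<open>The toppled site is added to F because mass is controlled only over sets that
      contain it. Its own term is nonnegative, so adding it does not decrease the sum.\<close>
    have "(\<Sum>y\<in>F. ?H' y - h) \<le> (\<Sum>y\<in>insert x F. ?H' y - h)"
      using F self h by (cases "x \<in> F") (auto simp: insert_absorb)
    also have "\<dots> \<le> (\<Sum>y\<in>insert x F. ?H y - h)"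
      using sum_particles_topple[of "insert x F" x c e "conf c e h n D t"] F
      by (simp only: H' sum_subtractf) simp
    also have "\<dots> \<le> int n - h" using adm F by (simp add: admissible_def del: sum.insert)
    finally show ?thesis .
  qed
  moreover have "?H' y \<ge> h" for y
  proof (cases "y = x")
    case True then show ?thesis using self h by simp
  next
    case False then show ?thesis using other[OF False] above[of y] by linarith
  qed
  moreover have "?t y > 0 \<longrightarrow> ?H' y \<ge> 0" for y
  proof (cases "y = x")
    case True then show ?thesis using self by simp
  next
    case False then show ?thesis using other[OF False] toppled[of y] by auto
  qed
  moreover have "\<exists>z. ?t z > 0 \<and> l1 z = k" if y: "?t y > 0" and k: "k \<le> l1 y" for y k
  proof (cases "t y > 0")
    case True
    then obtain z where "t z > 0" "l1 z = k" using adm k unfolding admissible_def by blast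
    then show ?thesis by (intro exI[of _ z]) simp
  next
    case False
    then have [simp]: "y = x" using y by (cases "y = x") auto
    show ?thesis
    proof (cases "k = l1 x")
      case False
      then have "x \<noteq> 0" using k by auto
      \<comment> \<open>A site other than the origin that topples for the first time has a neighbour
        that toppled earlier. That neighbour has l1 norm at least \<open>l1 x - 1\<close>, so no
        level below that of x is missing.\<close>
      have "?H x > h" using x h by simp
      then obtain v where v: "v \<in> units" "t (x + v) > 0"
        using received_imp_neighbour[OF enum _ \<open>x \<noteq> 0\<close>] by blast
      have "l1 x \<le> l1 (x + v) + l1 (- v)" using l1_triangle[of "x + v" "- v"] by simp
      then have "k \<le> l1 (x + v)" using l1_unit[OF v(1)] False k by (simp add: l1_minus)
      then obtain z where "t z > 0" "l1 z = k" using adm v(2) unfolding admissible_def by blast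
      then show ?thesis by (intro exI[of _ z]) simp
    qed (auto intro!: exI[of _ x])
  qed
  ultimately show "admissible c e h n D ?t" unfolding admissible_def by blast
qed

text \<open>One toppled site on each of the levels 0, ..., \<open>l1 x\<close> gives
  \<open>l1 x + 1\<close> sites, each at least 1 above the background, while the total excess is at
  most n - h.\<close>

lemma admissible_toppled:
  fixes t :: "int ^ 'd::finite \<Rightarrow> nat"
  assumes "admissible c e h n D t" "h < 0" "t x > 0"
  shows "l1 x \<le> nat (int n - h)"
proof -
  have "\<forall>k\<in>{..l1 x}. \<exists>y. t y > 0 \<and> l1 y = k"
    using assms unfolding admissible_def by blast
  then obtain y where y: "\<forall>k\<in>{..l1 x}. t (y k) > 0 \<and> l1 (y k) = k" by metis
  define F where "F = y ` {..l1 x}"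
  have "inj_on y {..l1 x}" using y by (metis inj_onI)
  then have "card F = l1 x + 1" by (simp add: F_def card_image)
  moreover have "finite F" by (simp add: F_def)
  moreover have "1 \<le> particles (conf c e h n D t) z - h" if "z \<in> F" for z
  proof -
    have "t z > 0" using that y by (auto simp: F_def)
    then have "particles (conf c e h n D t) z \<ge> 0" using assms(1) unfolding admissible_def by blast
    then show ?thesis using assms(2) by simp
  qed
  then have "(\<Sum>z\<in>F. 1) \<le> (\<Sum>z\<in>F. particles (conf c e h n D t) z - h)"
    by (rule sum_mono)
  moreover have "\<dots> \<le> int n - h" using assms \<open>finite F\<close> unfolding admissible_def by blast
  ultimately show ?thesis by simp
qed

text \<open>Conservation of mass on a singleton gives height at most n. The bound is far cruder than
  \<open>stable_lap\<close>, but it holds before stability is known.\<close>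

lemma admissible_lap:
  fixes e :: "nat \<Rightarrow> int ^ 'd::finite"
  assumes enum: "unit_vector_enum e" and "admissible c e h n D t" "h < 0"
  shows "lap (\<lambda>x. real (c * t x)) x \<le> 2 * real CARD('d) * (real n + \<bar>real_of_int h\<bar> + 2 * real CARD('d))"
proof -
  have "(\<Sum>x\<in>{x}. particles (conf c e h n D t) x - h) \<le> int n - h"
    using assms by (simp only: admissible_def) blast
  then have "real_of_int (particles (conf c e h n D t) x) \<le> real n" by simp
  then have "real_of_int (particles (conf c e h n D t) x) - (if x = 0 then real n else real_of_int h)
     + 2 * real CARD('d) \<le> real n + \<bar>real_of_int h\<bar> + 2 * real CARD('d)"
    using assms by auto
  then show ?thesis
    using lap_conf[OF enum, of c t x h n D] by (meson mult_left_mono order_trans of_nat_0_le_iff zero_le_mult_iff zero_le_numeral)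
qed

text \<open>A site on level L + 1 cannot have toppled, so it is a zero from which
  \<open>crude_harnack\<close> bounds every count. Toppled sites have level at most L, hence lie
  within l1 distance L + (L + 1) of it.\<close>

lemma admissible_bounded:
  fixes e :: "nat \<Rightarrow> int ^ 'd::finite"
  assumes enum: "unit_vector_enum e" and "h < 0" "c > 0"
  shows "\<exists>B. \<forall>t. admissible c e h n D t \<longrightarrow> (\<forall>x. t x \<le> B)"
proof -
  define L where "L = nat (int n - h)"
  define a where "a = real n + \<bar>real_of_int h\<bar> + 2 * real CARD('d)"
  define M where "M = harnack_bound (2 * real CARD('d)) a (L + (L + 1))"
  define far where "far = (axis undefined (int (L + 1)) :: int ^ 'd)"
  have "t x \<le> nat \<lceil>M\<rceil>" if adm: "admissible c e h n D t" for t x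
  proof (cases "t x = 0")
    case False
    have far: "l1 far = L + 1" by (simp add: far_def l1_axis)
    then have "t far = 0" using admissible_toppled[OF adm assms(2), of far] by (auto simp: L_def)
    have x: "l1 x \<le> L" using admissible_toppled[OF adm assms(2), of x] False by (simp add: L_def)
    have "real (c * t (far + (x - far))) \<le> harnack_bound (2 * real CARD('d)) a (l1 (x - far))"
      using admissible_lap[OF enum adm assms(2)] \<open>t far = 0\<close>
      by (intro crude_harnack) (auto simp: a_def)
    also have "\<dots> \<le> M"
      unfolding M_def using l1_triangle[of x "- far"] x far zero_less_card_finite[where 'a='d]
      by (intro harnack_bound_mono[THEN conjunct2]) (auto simp: l1_minus a_def simp del: zero_less_card_finite)
    finally have "real (c * t x) \<le> M" by simp
    moreover have "real (t x) \<le> real (c * t x)" using \<open>c > 0\<close> by (simp del: of_nat_mult)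
    ultimately show ?thesis by linarith
  qed simp
  then show ?thesis by blast
qed

text \<open>All topplings take place in the finite set \<Omega> and each site topples boundedly
  often, so some reachable t maximizes the total count. A maximizer is stable, since one more legal
  toppling would raise the total.\<close>

lemma stabilizing_exists:
  fixes e :: "nat \<Rightarrow> int ^ 'd::finite"
  assumes enum: "unit_vector_enum e" and D: "\<And>x. D x < 2 * CARD('d)" and h: "h < 0" and c: "c > 0"
  shows "\<exists>t. stabilizing c e h n D t"
proof -
  define R where "R t \<longleftrightarrow> (legal_topple c e)\<^sup>*\<^sup>* (initial_config h n D) (conf c e h n D t)" for t
  obtain B where B: "\<And>t x. admissible c e h n D t \<Longrightarrow> t x \<le> B"
    using admissible_bounded[OF enum h c] by metis
  define \<Omega> where "\<Omega> = {x :: int ^ 'd. l1 x \<le> nat (int n - h)}"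
  have fin: "finite \<Omega>" by (simp add: \<Omega>_def finite_l1_le)
  have adm: "admissible c e h n D t" if "R t" for t
    using reachable_admissible[where D = D, OF enum D h] that by (simp add: R_def)
  have "sum t \<Omega> \<le> card \<Omega> * B" if "R t" for t
    using sum_bounded_above[of \<Omega> t B] B[OF adm[OF that]] by simp
  moreover have "R (\<lambda>_. 0)" using conf_initial[of D h n c e] D by (simp add: R_def)
  ultimately obtain t where t: "R t" and max: "\<And>t'. R t' \<Longrightarrow> sum t' \<Omega> \<le> sum t \<Omega>"
    using ex_has_greatest_nat[of R "\<lambda>_. 0" "\<lambda>t. sum t \<Omega>" "Suc (card \<Omega> * B)"]
    by (metis less_Suc_eq_le)
  have "stable c (conf c e h n D t)"
  proof (rule ccontr)
    assume "\<not> ?thesis"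
    then obtain x where x: "particles (conf c e h n D t) x \<ge> int c"
      unfolding stable_def by (metis linorder_not_le zle_diff1_eq)
    define t' where "t' = t(x := Suc (t x))"
    have "legal_topple c e (conf c e h n D t) (conf c e h n D t')"
      using x unfolding legal_topple_conf[OF enum] t'_def by blast
    then have "R t'" using t unfolding R_def by (meson rtranclp.rtrancl_into_rtrancl)
    moreover have "x \<in> \<Omega>"
      using admissible_toppled[OF adm[OF \<open>R t'\<close>] h, of x] by (simp add: \<Omega>_def t'_def)
    then have "sum t \<Omega> < sum t' \<Omega>"
      using fin by (intro sum_strict_mono_ex1) (auto simp: t'_def)
    ultimately show False using max by force
  qed
  with t show ?thesis unfolding stabilizing_def R_def by blast
qed

lemma final_config_conf:
  fixes e :: "nat \<Rightarrow> int ^ 'd::finite"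
  assumes enum: "unit_vector_enum e" and D: "\<And>x. D x < 2 * CARD('d)" and h: "h < 0" and c: "c > 0"
  obtains t where "final_config c e h n D = conf c e h n D t"
    "admissible c e h n D t" "stable c (conf c e h n D t)"
proof -
  obtain t where t: "stabilizing c e h n D t" using stabilizing_exists[where D = D, OF assms] by blast
  have "final_config c e h n D = conf c e h n D t"
    unfolding final_config_def
  proof (rule the_equality)
    show "(legal_topple c e)\<^sup>*\<^sup>* (initial_config h n D) (conf c e h n D t) \<and> stable c (conf c e h n D t)"
      using t by (simp add: stabilizing_def)
  next
    fix s assume s: "(legal_topple c e)\<^sup>*\<^sup>* (initial_config h n D) s \<and> stable c s"
    then obtain t' where t': "s = conf c e h n D t'"
      using reachable_induct[where D = D and P = "\<lambda>_. True", OF enum D] by blast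
    have "t = t'"
      using least_action[where D = D and t = t and t' = t', OF enum D]
        least_action[where D = D and t = t' and t' = t, OF enum D] s t t'
      by (auto simp: stabilizing_def intro: antisym)
    then show "s = conf c e h n D t" using t' by simp
  qed
  moreover have "admissible c e h n D t"
    using reachable_admissible[where D = D, OF enum D h] t by (simp add: stabilizing_def)
  ultimately show ?thesis using that t by (simp add: stabilizing_def)
qed

text \<open>The constant 4d consists of 2d for the rounding in \<open>lap_conf\<close> and 2d for
  the height of a stable site, which is at most c - 1.\<close>

lemma stable_lap:
  fixes e :: "nat \<Rightarrow> int ^ 'd::finite"
  assumes enum: "unit_vector_enum e" and "stable c (conf c e h n D t)" "h < 0" "c \<le> 2 * CARD('d)"
  shows "lap (\<lambda>x. real (c * t x)) x \<le>
    2 * real CARD('d) * (\<bar>real_of_int h\<bar> + 4 * real CARD('d) - (if x = 0 then real n else 0))"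
proof -
  have "particles (conf c e h n D t) x \<le> int c - 1" using assms(2) by (simp only: stable_def)
  then have "real_of_int (particles (conf c e h n D t) x) \<le> 2 * real CARD('d)" using assms(4) by linarith
  then have "real_of_int (particles (conf c e h n D t) x) - (if x = 0 then real n else real_of_int h)
     + 2 * real CARD('d) \<le> \<bar>real_of_int h\<bar> + 4 * real CARD('d) - (if x = 0 then real n else 0)"
    using assms by auto
  then show ?thesis
    using lap_conf[OF enum, of c t x h n D] by (meson mult_left_mono order_trans of_nat_0_le_iff zero_le_mult_iff zero_le_numeral)
qed

section \<open>Comparison with a radial profile\<close>

definition embed :: "int ^ 'd::finite \<Rightarrow> real ^ 'd" where
  "embed x = (\<chi> i. real_of_int (x $ i))"

definition sqn :: "int ^ 'd::finite \<Rightarrow> real" where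
  "sqn x = (norm (embed x))\<^sup>2"

lemma sqn_alt: "sqn x = (\<Sum>i\<in>UNIV. (real_of_int (x $ i))\<^sup>2)"
  by (simp add: sqn_def embed_def norm_vec_def L2_set_def sum_nonneg)

lemma embed_add: "embed (x + y) = embed x + embed y"
  by (simp add: embed_def vec_eq_iff)

lemma embed_minus: "embed (- x) = - embed x"
  by (simp add: embed_def vec_eq_iff)

lemma embed_0 [simp]: "embed 0 = 0"
  by (simp add: embed_def vec_eq_iff)

lemma embed_axis: "embed (axis i a) = axis i (real_of_int a)"
  by (auto simp: embed_def vec_eq_iff axis_def)

lemma norm_embed_unit: "v \<in> units \<Longrightarrow> norm (embed v) = 1"
  by (auto simp: units_def embed_axis norm_eq_1 inner_axis)

lemma norm_axis_real: "(norm (axis i a :: real ^ 'd::finite))\<^sup>2 = a\<^sup>2"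
  unfolding power2_norm_eq_inner by (simp add: inner_axis power2_eq_square)

lemma sqn_axis:
  fixes x :: "int ^ 'd::finite"
  shows "sqn (x + axis i a) = sqn x + 2 * real_of_int (x $ i) * real_of_int a + (real_of_int a)\<^sup>2"
proof -
  have "sqn (x + axis i a) = (norm (embed x + axis i (real_of_int a)))\<^sup>2"
    by (simp add: sqn_def embed_add embed_axis)
  also have "\<dots> = (norm (embed x))\<^sup>2 + 2 * (embed x \<bullet> axis i (real_of_int a)) + (norm (axis i (real_of_int a) :: real ^ 'd))\<^sup>2"
    by (simp add: power2_norm_eq_inner inner_add inner_commute)
  also have "\<dots> = sqn x + 2 * real_of_int (x $ i) * real_of_int a + (real_of_int a)\<^sup>2"
    by (simp add: sqn_def inner_axis norm_axis_real) (simp add: embed_def)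
  finally show ?thesis .
qed

lemma finite_norm_embed: "finite {x :: int ^ 'd::finite. norm (embed x) \<le> L}"
proof (rule finite_subset[OF _ finite_coord_bounded[of "\<lceil>L\<rceil>"]], safe)
  fix x :: "int ^ 'd" and i assume "norm (embed x) \<le> L"
  then have "\<bar>embed x $ i\<bar> \<le> L" using component_le_norm_cart[of "embed x" i] by linarith
  then show "\<bar>x $ i\<bar> \<le> \<lceil>L\<rceil>" by (simp add: embed_def) linarith
qed

text \<open>The two neighbours in direction i have squared norms t + 1 + 2 x_i and t + 1 - 2 x_i
  with t = |x|^2. The second differences are thus centred at t + 1, and the offset from t is a
  separate loss in the estimates below.\<close>

lemma lap_radial:
  fixes x :: "int ^ 'd::finite"
  shows "lap (\<lambda>x. \<psi> (sqn x)) x = (\<Sum>i\<in>UNIV. \<psi> (sqn x + 1 + 2 * real_of_int (x $ i)) +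
      \<psi> (sqn x + 1 - 2 * real_of_int (x $ i)) - 2 * \<psi> (sqn x))"
  unfolding lap_def sum_units by (intro sum.cong refl) (simp add: sqn_axis algebra_simps)

lemma lap_sqn: "lap sqn (x :: int ^ 'd::finite) = 2 * real CARD('d)"
  using lap_radial[of "\<lambda>t. t" x] by simp

lemma lap_add: "lap (\<lambda>x. u x + v x) x = lap u x + lap v x"
  by (simp add: lap_alt sum.distrib algebra_simps)

lemma lap_cmult: "lap (\<lambda>x. a * u x) x = a * lap u x"
  by (simp add: lap_def sum_distrib_left right_diff_distrib)

lemma lap_const: "lap (\<lambda>_. a) x = 0"
  by (simp add: lap_def)

lemma lap_sum: "lap (\<lambda>x. \<Sum>y\<in>F. u y x) x = (\<Sum>y\<in>F. lap (u y) x)"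
  unfolding lap_def by (subst sum.swap) (simp add: sum_subtractf)

lemma lap_shift: "lap (\<lambda>x. u (x + y)) x = lap u (x + y)"
  by (simp add: lap_def add.assoc add.commute add.left_commute)

text \<open>At a negative minimum all differences to neighbours are nonnegative and their sum is at
  most 0, so they vanish. Among the minimizers take one with the largest i-th coordinate: its
  neighbour further along axis i is again a minimizer in \<Omega>, a contradiction.\<close>

lemma minimum_principle:
  fixes g :: "int ^ 'd::finite \<Rightarrow> real"
  assumes fin: "finite \<Omega>"
    and lap: "\<And>x. x \<in> \<Omega> \<Longrightarrow> lap g x \<le> 0"
    and boundary: "\<And>x v. x \<in> \<Omega> \<Longrightarrow> v \<in> units \<Longrightarrow> x + v \<notin> \<Omega> \<Longrightarrow> g (x + v) \<ge> 0"
    and x: "x \<in> \<Omega>"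
  shows "g x \<ge> 0"
proof (rule ccontr)
  assume "\<not> g x \<ge> 0"
  define \<mu> where "\<mu> = Min (g ` \<Omega>)"
  have \<mu>: "\<mu> \<le> g y" if "y \<in> \<Omega>" for y using that fin by (simp add: \<mu>_def)
  have "\<mu> \<in> g ` \<Omega>" unfolding \<mu>_def using fin x by (intro Min_in) auto
  then have ne: "{y \<in> \<Omega>. g y = \<mu>} \<noteq> {}" by auto
  have "\<mu> < 0" using \<mu>[OF x] \<open>\<not> g x \<ge> 0\<close> by simp
  define i where "i = (undefined :: 'd)"
  define Y where "Y = {y \<in> \<Omega>. g y = \<mu>}"
  have finY: "finite Y" using fin by (simp add: Y_def)
  define top where "top = Max ((\<lambda>y. y $ i) ` Y)"
  have "top \<in> (\<lambda>y. y $ i) ` Y" unfolding top_def using finY ne by (intro Max_in) (auto simp: Y_def)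
  then obtain y where y: "y \<in> Y" "y $ i = top" by auto
  define w where "w = (axis i 1 :: int ^ 'd)"
  have w: "w \<in> units" by (simp add: w_def units_def)
  have nbr: "g (y + v) - g y \<ge> 0" if "v \<in> units" for v
    using \<mu>[of "y + v"] boundary[of y v] y \<open>\<mu> < 0\<close> that by (cases "y + v \<in> \<Omega>") (auto simp: Y_def)
  have "(\<Sum>v\<in>units. g (y + v) - g y) \<le> 0" using lap[of y] y by (simp add: lap_def Y_def)
  moreover have "g (y + w) - g y \<le> (\<Sum>v\<in>units. g (y + v) - g y)"
    using w nbr by (intro member_le_sum) auto
  ultimately have "g (y + w) = \<mu>" using nbr[OF w] y by (auto simp: Y_def)
  moreover from this have "y + w \<in> \<Omega>" using boundary[of y w] w y \<open>\<mu> < 0\<close> by (force simp: Y_def)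
  ultimately have "y + w \<in> Y" by (simp add: Y_def)
  then have "(y + w) $ i \<le> top" unfolding top_def using finY by (intro Max_ge) (auto simp del: vector_add_component)
  then show False using y by (simp add: w_def)
qed

section \<open>Convexity estimates in one variable\<close>

lemma second_difference_ge:
  fixes \<psi> \<psi>' :: "real \<Rightarrow> real"
  assumes d1: "\<And>t. c \<le> t \<Longrightarrow> (\<psi> has_real_derivative \<psi>' t) (at t)"
    and d2: "\<And>t. c \<le> t \<Longrightarrow> (\<psi>' has_real_derivative \<psi>'' t) (at t within {c..})"
    and conv: "\<And>s. 0 \<le> s \<Longrightarrow> c \<le> u - s \<Longrightarrow> \<psi>'' (u + s) + \<psi>'' (u - s) \<ge> 2 * \<psi>'' u"
    and s: "c \<le> u - \<bar>s\<bar>"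
  shows "\<psi> (u + s) + \<psi> (u - s) - 2 * \<psi> u \<ge> \<psi>'' u * s\<^sup>2"
proof -
  \<comment> \<open>Here g and g' vanish at 0, and the derivative of g' is the defect in the
    midpoint convexity of \<psi>''. Two integrations give the claim.\<close>
  define g where "g s = \<psi> (u + s) + \<psi> (u - s) - 2 * \<psi> u - \<psi>'' u * s\<^sup>2" for s
  define g' where "g' s = \<psi>' (u + s) - \<psi>' (u - s) - 2 * \<psi>'' u * s" for s
  have g'_pos: "g' x \<ge> 0" if x: "0 \<le> x" "x \<le> \<bar>s\<bar>" for x
  proof -
    have "g' 0 \<le> g' x"
    proof (rule DERIV_nonneg_imp_increasing_open[where f = g', OF x(1)])
      fix y assume y: "0 < y" "y < x"
      have *: "(\<psi>' has_real_derivative \<psi>'' t) (at t)" if "c < t" for t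
        using d2[of t] that at_within_interior[of t "{c..}"] by simp
      have "(g' has_real_derivative (\<psi>'' (u + y) + \<psi>'' (u - y) - 2 * \<psi>'' u)) (at y)"
        unfolding g'_def using y x s
        by (auto intro!: derivative_eq_intros DERIV_chain2[OF *])
      moreover have "\<psi>'' (u + y) + \<psi>'' (u - y) - 2 * \<psi>'' u \<ge> 0"
        using conv[of y] y x s by simp
      ultimately show "\<exists>z. (g' has_real_derivative z) (at y) \<and> z \<ge> 0" by blast
    next
      \<comment> \<open>At the end of the interval u - y may equal c, where \<psi>' has only a
        one-sided derivative; continuity suffices there.\<close>
      have "continuous_on {c..} \<psi>'"
        by (auto simp: continuous_on_eq_continuous_within intro!: DERIV_continuous[OF d2])
      then show "continuous_on {0..x} g'"
        unfolding g'_def using x s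
        by (intro continuous_intros) (auto intro!: continuous_on_compose2[of "{c..}" \<psi>'] continuous_intros)
    qed
    then show ?thesis by (simp add: g'_def)
  qed
  have "g 0 \<le> g \<bar>s\<bar>"
  proof (rule DERIV_nonneg_imp_nondecreasing[where f = g])
    fix x assume x: "0 \<le> x" "x \<le> \<bar>s\<bar>"
    have "(g has_real_derivative g' x) (at x)"
      unfolding g_def g'_def using x s
      by (auto intro!: derivative_eq_intros DERIV_chain2[OF d1])
    then show "\<exists>y. (g has_real_derivative y) (at x) \<and> 0 \<le> y" using g'_pos[OF x] by blast
  qed simp
  then show ?thesis by (cases "s \<ge> 0") (auto simp: g_def add.commute)
qed

text \<open>The arithmetic-geometric mean inequality for the two powers, whose product is (v^2 -
  s^2)^(-\<beta>), at least v^(-2\<beta>).\<close>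

lemma powr_midpoint_convex:
  fixes v s \<beta> :: real
  assumes "0 \<le> s" "s < v" "\<beta> \<ge> 0"
  shows "(v + s) powr (-\<beta>) + (v - s) powr (-\<beta>) \<ge> 2 * v powr (-\<beta>)"
proof -
  have "v powr (-\<beta>) = (v * v) powr (-\<beta>/2)"
    using assms by (simp add: powr_mult powr_add[symmetric])
  also have "\<dots> \<le> ((v + s) * (v - s)) powr (-\<beta>/2)"
    using assms mult_strict_mono[of s v s v] by (intro powr_mono2') (auto simp: algebra_simps)
  also have "\<dots> = sqrt ((v + s) powr (-\<beta>) * (v - s) powr (-\<beta>))"
    using assms by (simp add: powr_mult real_sqrt_mult powr_half_sqrt[symmetric] powr_powr)
  also have "\<dots> \<le> ((v + s) powr (-\<beta>) + (v - s) powr (-\<beta>)) / 2"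
    by (intro arith_geo_mean_sqrt) auto
  finally show ?thesis by simp
qed

lemma one_plus_power_le:
  assumes "0 \<le> (y::real)" "y \<le> 1"
  shows "(1 + y) ^ d \<le> 1 + (2 ^ d - 1) * y"
proof (induction d)
  case (Suc d)
  have "(1 + y) ^ Suc d \<le> (1 + (2 ^ d - 1) * y) * (1 + y)"
    using Suc assms by (simp add: mult.commute mult_left_mono)
  also have "\<dots> = 1 + 2 ^ d * y + (2 ^ d - 1) * (y * y)" by (simp add: algebra_simps)
  also have "\<dots> \<le> 1 + 2 ^ d * y + (2 ^ d - 1) * y"
    using assms by (intro add_left_mono mult_left_mono) (auto simp: mult_left_le)
  finally show ?case by (simp add: algebra_simps)
qed simp

text \<open>As a function of \<open>t = \<bar>x\<bar>\<^sup>2\<close>, the fundamental solution has derivative proportional to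
  \<open>- (t powr (- d/2))\<close> in every dimension. Shifting the argument by \<open>b\<close> makes it subharmonic for the
  lattice Laplacian away from the origin; making the derivative constant for \<open>t \<le> t0\<close> turns the singularity into
  a uniform mass on a ball.\<close>

definition shift :: "nat \<Rightarrow> real" where
  "shift d = 1 + 2 * 2 ^ d"

definition profile :: "nat \<Rightarrow> real \<Rightarrow> real \<Rightarrow> real" where
  "profile d t0 t = (max t t0 - shift d) powr (- real d / 2)"

lemma profile_antimono:
  assumes "shift d < t0" "s \<le> t"
  shows "profile d t0 t \<le> profile d t0 s"
  unfolding profile_def using assms by (intro powr_mono2') auto

lemma profile_le:
  assumes "shift d < t0"
  shows "profile d t0 t \<le> (t0 - shift d) powr (- real d / 2)"
  unfolding profile_def using assms by (intro powr_mono2') auto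

text \<open>This inequality dictates the value of \<open>shift\<close>. With u = t -
  \<open>shift d\<close> it lets the second-order term at t + 1 dominate the first-order term at t
  in \<open>lap_profile_nonneg\<close>. The proof uses ((u + 1) / u)^(d/2) \<le> 1 + 2^d / u and (u
  + 1) / u \<le> 2.\<close>

lemma shift_ineq:
  assumes u: "u \<ge> 1"
  shows "u powr (- real d / 2) \<le> (u + shift d) * (u + 1) powr (- real d / 2 - 1)"
proof -
  have "((u + 1) / u) powr (real d / 2) \<le> ((u + 1) / u) powr (real d)"
    using u by (intro powr_mono) auto
  also have "\<dots> = (1 + 1 / u) ^ d" using u by (subst powr_realpow) (auto simp: add_divide_distrib add_pos_pos)
  also have "\<dots> \<le> 1 + (2 ^ d - 1) * (1 / u)" using u by (intro one_plus_power_le) auto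
  also have "\<dots> \<le> 1 + 2 ^ d / u" using u by (simp add: divide_right_mono)
  finally have *: "((u + 1) / u) powr (real d / 2) \<le> 1 + 2 ^ d / u" .
  have "(u + 1) * (1 + 2 ^ d / u) = u + 1 + 2 ^ d * ((u + 1) / u)" using u by (simp add: field_simps)
  also have "\<dots> \<le> u + 1 + 2 ^ d * 2" using u by (intro add_left_mono mult_left_mono) (auto simp: divide_simps)
  also have "\<dots> = u + shift d" by (simp add: shift_def)
  finally have "(u + 1) * ((u + 1) / u) powr (real d / 2) \<le> u + shift d"
    using mult_left_mono[OF *, of "u + 1"] u by linarith
  then have "(u + 1) * ((u + 1) / u) powr (real d / 2) * (u + 1) powr (- real d / 2 - 1)
      \<le> (u + shift d) * (u + 1) powr (- real d / 2 - 1)"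
    by (intro mult_right_mono) auto
  moreover have "(u + 1) * ((u + 1) / u) powr (real d / 2) * (u + 1) powr (- real d / 2 - 1) = u powr (- real d / 2)"
  proof -
    have "- real d / 2 - 1 = - (real d / 2 + 1)" by simp
    then have "(u + 1) powr (- real d / 2 - 1) = inverse ((u + 1) powr (real d / 2 + 1))"
      by (simp only: powr_minus)
    also have "\<dots> = inverse ((u + 1) powr (real d / 2) * (u + 1))"
      using u by (simp add: powr_add)
    finally have 1: "(u + 1) powr (- real d / 2 - 1) = inverse ((u + 1) powr (real d / 2) * (u + 1))" .
    have 2: "((u + 1) / u) powr (real d / 2) = (u + 1) powr (real d / 2) / u powr (real d / 2)"
      using u by (simp add: powr_divide)
    have 3: "u powr (- real d / 2) = inverse (u powr (real d / 2))"
      by (simp only: powr_minus minus_divide_left[symmetric])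
    have "(u + 1) powr (real d / 2) > 0" using u by simp
    then show ?thesis using u unfolding 1 2 3 by (simp add: divide_simps)
  qed
  ultimately show ?thesis by simp
qed

text \<open>Only the derivative of \<psi> is ever used, so no case distinction for the logarithm in
  dimension 2 arises. Integrating from -1 makes the derivative two-sided at every value t \<ge> 0 of
  \<open>sqn\<close>, including 0.\<close>

lemma profile_antiderivative:
  assumes "shift d < t0"
  obtains \<psi> where "\<And>t. t > -1 \<Longrightarrow> (\<psi> has_real_derivative - profile d t0 t) (at t)"
proof -
  define \<psi> where "\<psi> t = - integral {-1..t} (profile d t0)" for t
  have "continuous_on UNIV (profile d t0)"
    unfolding profile_def using assms by (intro continuous_intros) auto
  then have cont: "continuous_on S (profile d t0)" for S using continuous_on_subset by blast
  have "(\<psi> has_real_derivative - profile d t0 t) (at t)" if t: "t > -1" for t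
  proof -
    have "((\<lambda>u. integral {-1..u} (profile d t0)) has_real_derivative profile d t0 t) (at t within {-1..t + 1})"
      using t by (intro integral_has_real_derivative cont) auto
    then have "((\<lambda>u. integral {-1..u} (profile d t0)) has_real_derivative profile d t0 t) (at t)"
      using t at_within_interior[of t "{-1..t + 1}"] by simp
    then show ?thesis unfolding \<psi>_def by (rule DERIV_minus)
  qed
  then show ?thesis using that by blast
qed

text \<open>\<psi> is convex because its derivative, minus the decreasing \<open>profile\<close>, is
  increasing; its graph lies above its tangents.\<close>

lemma profile_tangent:
  assumes b: "shift d < t0" and \<psi>: "\<And>t. t > -1 \<Longrightarrow> (\<psi> has_real_derivative - profile d t0 t) (at t)"
    and s: "s > -1" "t > -1"
  shows "\<psi> s - \<psi> t \<ge> profile d t0 t * (t - s)"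
proof (cases s t rule: linorder_cases)
  case less
  then obtain z where z: "s < z" "z < t" "\<psi> t - \<psi> s = (t - s) * (- profile d t0 z)"
    using MVT2[of s t \<psi> "\<lambda>z. - profile d t0 z"] \<psi> s by auto
  have "(t - s) * profile d t0 t \<le> (t - s) * profile d t0 z"
    using profile_antimono[OF b, of z t] z less by (intro mult_left_mono) auto
  then show ?thesis using z(3) by (simp add: mult.commute)
next
  case greater
  then obtain z where z: "t < z" "z < s" "\<psi> s - \<psi> t = (s - t) * (- profile d t0 z)"
    using MVT2[of t s \<psi> "\<lambda>z. - profile d t0 z"] \<psi> s by auto
  have "(s - t) * profile d t0 z \<le> (s - t) * profile d t0 t"
    using profile_antimono[OF b, of t z] z greater by (intro mult_left_mono) auto
  then show ?thesis using z(3) by (simp add: algebra_simps)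
qed simp

lemma sqn_nonneg [simp]: "sqn x \<ge> 0"
  by (simp add: sqn_def)

text \<open>With the tangent at t + 1, the contributions of the two neighbours in direction i cancel
  to first order. Each coordinate is left with twice \<psi>(t + 1) - \<psi>(t), which is at least
  \<open>- p0\<close> by the truncation.\<close>

lemma lap_profile_ge:
  fixes x :: "int ^ 'd::finite"
  assumes b: "shift (CARD('d)) < t0"
    and \<psi>: "\<And>t. t > -1 \<Longrightarrow> (\<psi> has_real_derivative - profile (CARD('d)) t0 t) (at t)"
  shows "lap (\<lambda>x. \<psi> (sqn x)) x \<ge> - (2 * real CARD('d) * (t0 - shift (CARD('d))) powr (- real CARD('d) / 2))"
proof -
  let ?d = "CARD('d)"
  let ?p0 = "(t0 - shift ?d) powr (- real ?d / 2)" and ?t = "sqn x"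
  note tangent = profile_tangent[OF b \<psi>]
  have "(\<Sum>i\<in>(UNIV :: 'd set). - 2 * ?p0) \<le> lap (\<lambda>x. \<psi> (sqn x)) x"
    unfolding lap_radial
  proof (intro sum_mono)
    fix i :: 'd
    let ?s = "2 * real_of_int (x $ i)"
    have pos: "?t + 1 + ?s \<ge> 0" "?t + 1 - ?s \<ge> 0" "?t \<ge> 0"
      using sqn_nonneg[of "x + axis i 1"] sqn_nonneg[of "x + axis i (-1)"]
      by (simp_all add: sqn_axis algebra_simps)
    have "\<psi> (?t + 1 + ?s) - \<psi> (?t + 1) \<ge> profile ?d t0 (?t + 1) * (- ?s)"
      using tangent[of "?t + 1 + ?s" "?t + 1"] pos by simp
    moreover have "\<psi> (?t + 1 - ?s) - \<psi> (?t + 1) \<ge> profile ?d t0 (?t + 1) * ?s"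
      using tangent[of "?t + 1 - ?s" "?t + 1"] pos by simp
    moreover have "\<psi> (?t + 1) - \<psi> ?t \<ge> - profile ?d t0 ?t"
      using tangent[of "?t + 1" "?t"] pos by simp
    moreover have "profile ?d t0 ?t \<le> ?p0" by (rule profile_le[OF b])
    ultimately show "- 2 * ?p0 \<le> \<psi> (?t + 1 + ?s) + \<psi> (?t + 1 - ?s) - 2 * \<psi> ?t"
      by linarith
  qed
  then show ?thesis by simp
qed

text \<open>Summed over the coordinates, the second differences about t + 1 contribute at least 4
  \<psi>''(t + 1) |x|^2, and the offset from t to t + 1 costs at most 2d times
  \<open>profile\<close> at t. \<open>shift_ineq\<close> compares the two.\<close>

lemma lap_profile_nonneg:
  fixes x :: "int ^ 'd::finite"
  assumes K: "K \<ge> 0" "shift (CARD('d)) < K\<^sup>2"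
    and \<psi>: "\<And>t. t > -1 \<Longrightarrow> (\<psi> has_real_derivative - profile (CARD('d)) (K\<^sup>2) t) (at t)"
    and x: "norm (embed x) \<ge> K + 1"
  shows "lap (\<lambda>x. \<psi> (sqn x)) x \<ge> 0"
proof -
  let ?d = "CARD('d)"
  let ?t = "sqn x" and ?b = "shift ?d"
  define \<psi>'' where "\<psi>'' t = real ?d / 2 * (t - ?b) powr (- real ?d / 2 - 1)" for t
  have t: "?t \<ge> (K + 1)\<^sup>2" using x K unfolding sqn_def by (intro power_mono) auto
  have "(K + 1)\<^sup>2 \<ge> K\<^sup>2 + 1" using K by (simp add: power2_eq_square algebra_simps)
  then have tb: "?t - ?b \<ge> 1" "?t \<ge> K\<^sup>2" using t K by linarith+
  have "(\<Sum>i\<in>UNIV. \<psi>'' (?t + 1) * (2 * real_of_int (x $ i))\<^sup>2 - 2 * profile ?d (K\<^sup>2) ?t)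
      \<le> lap (\<lambda>x. \<psi> (sqn x)) x"
    unfolding lap_radial
  proof (intro sum_mono)
    fix i :: 'd
    let ?s = "2 * real_of_int (x $ i)"
    have "\<bar>real_of_int (x $ i)\<bar> \<le> norm (embed x)"
      using component_le_norm_cart[of "embed x" i] by (simp add: embed_def)
    moreover have "K\<^sup>2 \<le> (norm (embed x) - 1)\<^sup>2" using x K by (intro power_mono) auto
    \<comment> \<open>The margin 1 in |x| \<ge> K + 1 is used here: t + 1 - 2 |x_i| \<ge> (|x| -
      1)^2 \<ge> K^2 keeps both neighbours beyond the truncation.\<close>
    ultimately have s: "K\<^sup>2 \<le> ?t + 1 - \<bar>?s\<bar>"
      by (simp add: sqn_def power2_eq_square algebra_simps)
    have "\<psi> (?t + 1 + ?s) + \<psi> (?t + 1 - ?s) - 2 * \<psi> (?t + 1) \<ge> \<psi>'' (?t + 1) * ?s\<^sup>2"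
    proof (rule second_difference_ge[where c = "K\<^sup>2" and \<psi>' = "\<lambda>t. - ((t - ?b) powr (- real ?d / 2))"])
      fix t assume "K\<^sup>2 \<le> t"
      moreover from this have "t > -1" using zero_le_power2[of K] by linarith
      ultimately show "(\<psi> has_real_derivative - ((t - ?b) powr (- real ?d / 2))) (at t)"
        using \<psi>[of t] by (simp add: profile_def max_def)
    next
      fix t assume "K\<^sup>2 \<le> t"
      then have "t - ?b > 0" using K by simp
      then have "((\<lambda>t. (t - ?b) powr (- real ?d / 2)) has_real_derivative
          (- real ?d / 2) * (t - ?b) powr (- real ?d / 2 - 1)) (at t)"
        by (auto intro!: derivative_eq_intros)
      then have "((\<lambda>t. - ((t - ?b) powr (- real ?d / 2))) has_real_derivative \<psi>'' t) (at t)"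
        using DERIV_minus by (fastforce simp: \<psi>''_def)
      then show "((\<lambda>t. - ((t - ?b) powr (- real ?d / 2))) has_real_derivative \<psi>'' t) (at t within {K\<^sup>2..})"
        by (rule has_field_derivative_at_within)
    next
      fix s assume s: "0 \<le> s" "K\<^sup>2 \<le> ?t + 1 - s"
      define v where "v = ?t + 1 - ?b"
      have "(v + s) powr (- (real ?d / 2 + 1)) + (v - s) powr (- (real ?d / 2 + 1)) \<ge> 2 * v powr (- (real ?d / 2 + 1))"
        using s K by (intro powr_midpoint_convex) (auto simp: v_def)
      then have "real ?d / 2 * (2 * v powr (- real ?d / 2 - 1)) \<le> real ?d / 2 *
          ((v + s) powr (- real ?d / 2 - 1) + (v - s) powr (- real ?d / 2 - 1))"
        by (intro mult_left_mono) auto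
      moreover have "v + s = ?t + 1 + s - ?b" "v - s = ?t + 1 - s - ?b" by (auto simp: v_def)
      ultimately show "2 * \<psi>'' (?t + 1) \<le> \<psi>'' (?t + 1 + s) + \<psi>'' (?t + 1 - s)"
        by (simp add: \<psi>''_def v_def[symmetric] distrib_left)
    qed (use s in auto)
    moreover have "\<psi> (?t + 1) - \<psi> ?t \<ge> - profile ?d (K\<^sup>2) ?t"
      using profile_tangent[OF K(2) \<psi>, of "?t + 1" ?t] sqn_nonneg[of x] by simp
    ultimately show "\<psi>'' (?t + 1) * ?s\<^sup>2 - 2 * profile ?d (K\<^sup>2) ?t
        \<le> \<psi> (?t + 1 + ?s) + \<psi> (?t + 1 - ?s) - 2 * \<psi> ?t" by linarith
  qed
  moreover have "(\<Sum>i\<in>UNIV. \<psi>'' (?t + 1) * (2 * real_of_int (x $ i))\<^sup>2 - 2 * profile ?d (K\<^sup>2) ?t)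
      = 4 * \<psi>'' (?t + 1) * ?t - 2 * real ?d * profile ?d (K\<^sup>2) ?t"
  proof -
    have "(\<Sum>i\<in>UNIV. w * (2 * real_of_int (x $ i))\<^sup>2 - 2 * q) = 4 * w * ?t - 2 * real ?d * q" for w q
      by (simp add: sum_subtractf sqn_alt sum_distrib_left power_mult_distrib algebra_simps)
    then show ?thesis .
  qed
  moreover have "profile ?d (K\<^sup>2) ?t \<le> ?t * (?t - ?b + 1) powr (- real ?d / 2 - 1)"
    using shift_ineq[OF tb(1), of ?d] tb(2) by (simp add: profile_def max_def)
  then have "2 * real ?d * profile ?d (K\<^sup>2) ?t \<le> 2 * real ?d * (?t * (?t - ?b + 1) powr (- real ?d / 2 - 1))"
    by (intro mult_left_mono) auto
  moreover have "\<dots> = 4 * \<psi>'' (?t + 1) * ?t"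
    by (simp add: \<psi>''_def algebra_simps)
  ultimately show ?thesis by linarith
qed

lemma smoothed_lower_bound:
  fixes u :: "int ^ 'd::finite \<Rightarrow> real" and K :: real
  defines "Q \<equiv> {y :: int ^ 'd. norm (embed y) \<le> K + 1}"
    and "p0 \<equiv> (K\<^sup>2 - shift (CARD('d))) powr (- real CARD('d) / 2)"
  assumes K: "K \<ge> 0" "shift (CARD('d)) < K\<^sup>2"
    and \<psi>: "\<And>t. t > -1 \<Longrightarrow> (\<psi> has_real_derivative - profile (CARD('d)) (K\<^sup>2) t) (at t)"
    and n: "n \<ge> 0"
    and nonneg: "\<And>x. u x \<ge> 0"
    and lap: "\<And>x. lap u x \<le> 2 * real CARD('d) * (a - (if x = 0 then n else 0))"
    and \<kappa>: "\<kappa> \<ge> 0" "a * p0 * real (card Q) \<le> n * \<kappa>"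
    and t1: "t1 \<ge> 0"
    and x: "sqn x < t1"
  shows "p0 * (\<Sum>y\<in>Q. u (x + y)) \<ge> n * (\<psi> (sqn x) - \<psi> t1 + \<kappa> * (sqn x - t1) - \<kappa> * (2 * sqrt t1 + 1))"
proof -
  let ?d = "real CARD('d)"
  have finQ: "finite Q" by (simp add: Q_def finite_norm_embed)
  have p0: "p0 \<ge> 0" by (simp add: p0_def)
  \<comment> \<open>g is superharmonic: on \<open>Q\<close> the spread-out source offsets the worst
    Laplacian of -n \<psi>, off \<open>Q\<close> the term -n \<psi> is itself superharmonic, and -n
    \<kappa> |x|^2 absorbs the background a. The additive constant makes g nonnegative just outside
    the ball.\<close>
  define g where "g x = p0 * (\<Sum>y\<in>Q. u (x + y)) + ((- n) * \<psi> (sqn x) + ((- n * \<kappa>) * sqn x + n * (\<psi> t1 + \<kappa> * t1 + \<kappa> * (2 * sqrt t1 + 1))))" for x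
  have lap_g: "lap g x \<le> 0" for x
  proof -
    have "lap g x = p0 * (\<Sum>y\<in>Q. lap u (x + y)) - n * lap (\<lambda>x. \<psi> (sqn x)) x - n * \<kappa> * (2 * ?d)"
      unfolding g_def lap_add lap_cmult lap_sum lap_shift lap_const lap_sqn by simp
    moreover have "(\<Sum>y\<in>Q. lap u (x + y)) \<le> (\<Sum>y\<in>Q. 2 * ?d * a - (if y = - x then 2 * ?d * n else 0))"
    proof (intro sum_mono)
      fix y
      have "x + y = 0 \<longleftrightarrow> y = - x" by (metis add_eq_0_iff)
      then show "lap u (x + y) \<le> 2 * ?d * a - (if y = - x then 2 * ?d * n else 0)"
        using lap[of "x + y"] by (simp add: right_diff_distrib split: if_splits)
    qed
    then have "(\<Sum>y\<in>Q. lap u (x + y)) \<le> 2 * ?d * a * real (card Q) - (if - x \<in> Q then 2 * ?d * n else 0)"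
      using finQ by (simp add: sum_subtractf mult.commute mult.left_commute split: if_splits)
    then have "p0 * (\<Sum>y\<in>Q. lap u (x + y)) \<le> p0 * (2 * ?d * a * real (card Q) - (if - x \<in> Q then 2 * ?d * n else 0))"
      using p0 by (rule mult_left_mono)
    then have "p0 * (\<Sum>y\<in>Q. lap u (x + y)) \<le> 2 * ?d * (a * p0 * real (card Q)) - (if - x \<in> Q then n * (2 * ?d * p0) else 0)"
      by (simp add: right_diff_distrib mult.commute mult.left_commute split: if_splits)
    moreover have "2 * ?d * (a * p0 * real (card Q)) \<le> 2 * ?d * (n * \<kappa>)"
      using \<kappa>(2) by (intro mult_left_mono) auto
    moreover have "- (n * lap (\<lambda>x. \<psi> (sqn x)) x) \<le> (if - x \<in> Q then n * (2 * ?d * p0) else 0)"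
    proof (cases "- x \<in> Q")
      case True
      have "n * (- (2 * ?d * p0)) \<le> n * lap (\<lambda>x. \<psi> (sqn x)) x"
        unfolding p0_def using n by (intro mult_left_mono lap_profile_ge[OF K(2) \<psi>]) auto
      then show ?thesis using True by simp
    next
      case False
      then have "norm (embed x) \<ge> K + 1" by (simp add: Q_def embed_minus)
      then have "lap (\<lambda>x. \<psi> (sqn x)) x \<ge> 0" by (intro lap_profile_nonneg[OF K \<psi>])
      then show ?thesis using False n by simp
    qed
    moreover have "n * \<kappa> * (2 * ?d) = 2 * ?d * (n * \<kappa>)" by simp
    ultimately show ?thesis by linarith
  qed
  have "g x \<ge> 0"
  proof (rule minimum_principle[where \<Omega> = "{x. sqn x < t1}"])
    have "{x. sqn x < t1} \<subseteq> {x :: int ^ 'd. norm (embed x) \<le> sqrt t1}"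
      by (auto simp: sqn_def intro: real_le_rsqrt)
    then show "finite {x :: int ^ 'd. sqn x < t1}" using finite_norm_embed finite_subset by blast
    fix x v :: "int ^ 'd" assume x: "x \<in> {x. sqn x < t1}" and v: "v \<in> units" and "x + v \<notin> {x. sqn x < t1}"
    let ?t = "sqn (x + v)"
    have t: "?t \<ge> t1" using \<open>x + v \<notin> _\<close> by simp
    have "norm (embed (x + v)) \<le> norm (embed x) + 1"
      using norm_triangle_ineq[of "embed x" "embed v"] norm_embed_unit[OF v] by (simp add: embed_add)
    also have "norm (embed x) \<le> sqrt t1" using x by (auto simp: sqn_def intro: real_le_rsqrt)
    finally have "?t \<le> (sqrt t1 + 1)\<^sup>2" unfolding sqn_def by (intro power_mono) auto
    \<comment> \<open>A boundary point lies less than one step outside the ball of radius sqrt t1.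
      This overshoot is the origin of the error term 2 sqrt t1 + 1.\<close>
    then have t': "?t - t1 \<le> 2 * sqrt t1 + 1" using t1 by (simp add: power2_eq_square algebra_simps)
    have "0 \<le> profile (CARD('d)) (K\<^sup>2) ?t" by (simp add: profile_def)
    then have "0 \<le> profile (CARD('d)) (K\<^sup>2) ?t * (?t - t1)" using t by (intro mult_nonneg_nonneg) auto
    then have "\<psi> ?t \<le> \<psi> t1"
      using profile_tangent[OF K(2) \<psi>, of t1 ?t] t t1 by linarith
    moreover have "\<kappa> * (?t - t1) \<le> \<kappa> * (2 * sqrt t1 + 1)" using t' \<kappa> by (intro mult_left_mono)
    ultimately have "0 \<le> n * (- \<psi> ?t - \<kappa> * ?t + (\<psi> t1 + \<kappa> * t1 + \<kappa> * (2 * sqrt t1 + 1)))"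
      using n by (intro mult_nonneg_nonneg) (auto simp: algebra_simps)
    moreover have "p0 * (\<Sum>y\<in>Q. u (x + v + y)) \<ge> 0"
      using p0 nonneg by (intro mult_nonneg_nonneg sum_nonneg) auto
    ultimately show "g (x + v) \<ge> 0" by (simp add: g_def algebra_simps)
  qed (use lap_g x in auto)
  then show ?thesis by (simp add: g_def algebra_simps)
qed

text \<open>As \<kappa> is \<open>profile\<close> at t1, the function \<psi>(t) + \<kappa> t
  decreases up to t1 with slope 0 at the end. From t to \<theta>' t1, a length of at least
  (\<theta>' - \<theta>) t1, it falls at rate at least (\<theta>'^(-d/2) - 1) \<kappa>; the
  remaining stretch contributes no loss. The gain is linear in t1.\<close>

lemma profile_drop:
  assumes b: "shift d < t0" and \<psi>: "\<And>t. t > -1 \<Longrightarrow> (\<psi> has_real_derivative - profile d t0 t) (at t)"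
    and \<theta>: "0 < \<theta>" "\<theta> < 1" and \<theta>': "\<theta>' = (1 + \<theta>) / 2"
    and t: "0 \<le> t" "t \<le> \<theta> * t1" and t1: "t0 \<le> \<theta>' * t1" and \<kappa>: "\<kappa> = (t1 - shift d) powr (- real d / 2)"
  shows "\<psi> t - \<psi> t1 + \<kappa> * (t - t1) \<ge> \<kappa> * t1 * ((\<theta>' - \<theta>) * (\<theta>' powr (- real d / 2) - 1))"
proof -
  have sh: "shift d > 0" by (simp add: shift_def add_pos_pos)
  have \<theta>'1: "0 < \<theta>'" "\<theta>' < 1" "\<theta> < \<theta>'" using \<theta> by (auto simp: \<theta>')
  have "\<theta>' * t1 > 0" using t1 b sh by linarith
  then have t1pos: "t1 > 0" using \<theta>'1 by (simp add: zero_less_mult_iff)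
  have "\<theta>' * t1 < t1" using t1pos \<theta>'1 by simp
  have "\<psi> t - \<psi> (\<theta>' * t1) \<ge> profile d t0 (\<theta>' * t1) * (\<theta>' * t1 - t)"
    using t t1pos \<theta>'1 by (intro profile_tangent[OF b \<psi>]) (auto intro: less_le_trans[of _ 0])
  moreover have "\<psi> (\<theta>' * t1) - \<psi> t1 \<ge> profile d t0 t1 * (t1 - \<theta>' * t1)"
    using t1pos \<theta>'1 by (intro profile_tangent[OF b \<psi>]) (auto intro: less_le_trans[of _ 0])
  moreover have "profile d t0 t1 = \<kappa>" using \<open>\<theta>' * t1 < t1\<close> t1 by (simp add: profile_def \<kappa> max_def)
  ultimately have 1: "\<psi> t - \<psi> t1 + \<kappa> * (t - t1) \<ge> (profile d t0 (\<theta>' * t1) - \<kappa>) * (\<theta>' * t1 - t)"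
    by (simp add: algebra_simps)
  have "\<theta>' powr (- real d / 2) * \<kappa> = (\<theta>' * (t1 - shift d)) powr (- real d / 2)"
    using \<theta>'1 \<open>\<theta>' * t1 < t1\<close> t1 b by (simp add: \<kappa> powr_mult)
  also have "\<dots> \<le> (\<theta>' * t1 - shift d) powr (- real d / 2)"
    using \<theta>'1 t1 b sh by (intro powr_mono2') (auto simp: algebra_simps)
  also have "\<dots> = profile d t0 (\<theta>' * t1)" using t1 by (simp add: profile_def max_def)
  finally have 2: "(\<theta>' powr (- real d / 2) - 1) * \<kappa> \<le> profile d t0 (\<theta>' * t1) - \<kappa>"
    by (simp add: algebra_simps)
  have pos: "0 \<le> (\<theta>' powr (- real d / 2) - 1) * \<kappa>"
  proof (rule mult_nonneg_nonneg)
    have "1 powr (- real d / 2) \<le> \<theta>' powr (- real d / 2)" using \<theta>'1 by (intro powr_mono2') auto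
    then show "0 \<le> \<theta>' powr (- real d / 2) - 1" by simp
  qed (simp add: \<kappa>)
  have "(\<theta>' powr (- real d / 2) - 1) * \<kappa> * ((\<theta>' - \<theta>) * t1) \<le>
      (profile d t0 (\<theta>' * t1) - \<kappa>) * (\<theta>' * t1 - t)"
    using 2 pos t \<theta>'1 t1pos by (intro mult_mono) (auto simp: algebra_simps)
  with 1 show ?thesis by (simp add: algebra_simps)
qed

section \<open>Lattice balls and their volume\<close>

lemma mem_unit_cube: "z \<in> unit_cube x \<longleftrightarrow> (\<forall>i. \<bar>z $ i - real_of_int (x $ i)\<bar> \<le> 1 / 2)"
proof -
  have "z \<in> unit_cube x \<longleftrightarrow> z - embed x \<in> cbox (\<chi> i. - (1/2)) (\<chi> i. 1/2)"
    unfolding unit_cube_def embed_def[symmetric] by (auto simp: image_iff) (metis add_diff_cancel_left' add.commute diff_add_cancel)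
  also have "\<dots> \<longleftrightarrow> (\<forall>i. \<bar>z $ i - real_of_int (x $ i)\<bar> \<le> 1 / 2)"
  proof -
    have "- (1/2) \<le> a \<and> a \<le> 1/2 \<longleftrightarrow> \<bar>a\<bar> \<le> 1/2" for a :: real by linarith
    then show ?thesis by (simp only: mem_box_cart embed_def vec_lambda_beta vector_minus_component)
  qed
  finally show ?thesis .
qed

lemma norm_le_sqrt_card:
  fixes v :: "real ^ 'd::finite"
  assumes "\<And>i. \<bar>v $ i\<bar> \<le> 1"
  shows "norm v \<le> sqrt (real CARD('d))"
proof -
  have "(v $ i)\<^sup>2 \<le> 1" for i using assms[of i] by (simp add: abs_square_le_1)
  then have "(\<Sum>i\<in>UNIV. (v $ i)\<^sup>2) \<le> (\<Sum>i\<in>(UNIV :: 'd set). 1)" by (intro sum_mono)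
  then show ?thesis by (simp add: norm_vec_def L2_set_def)
qed

lemma norm_unit_cube:
  fixes z :: "real ^ 'd::finite"
  assumes "z \<in> unit_cube x"
  shows "norm (z - embed x) \<le> sqrt (real CARD('d))"
proof (rule norm_le_sqrt_card)
  fix i
  have "\<bar>z $ i - real_of_int (x $ i)\<bar> \<le> 1 / 2" using assms by (simp only: mem_unit_cube)
  then show "\<bar>(z - embed x) $ i\<bar> \<le> 1" by (simp add: embed_def)
qed

lemma unit_cube_cover:
  fixes z :: "real ^ 'd::finite"
  obtains x where "z \<in> unit_cube x"
proof
  have "\<bar>z $ i - real_of_int (round (z $ i))\<bar> \<le> 1 / 2" for i
    using of_int_round_abs_le[of "z $ i"] by linarith
  then show "z \<in> unit_cube (\<chi> i. round (z $ i))" by (simp only: mem_unit_cube vec_lambda_beta) blast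
qed

lemma unit_cube_cbox: "unit_cube x = cbox (embed x + (\<chi> i. - (1/2))) (embed x + (\<chi> i. 1/2))"
  by (simp add: unit_cube_def embed_def[symmetric] cbox_translation)

lemma scaled_cube_measure:
  fixes x :: "int ^ 'd::finite"
  assumes "s > 0"
  shows "(*\<^sub>R) s ` unit_cube x \<in> sets lebesgue"
    and "emeasure lebesgue ((*\<^sub>R) s ` unit_cube x) = ennreal (s ^ CARD('d))"
proof -
  have "embed x \<in> unit_cube x" by (simp add: mem_unit_cube embed_def)
  then have "unit_cube x \<noteq> {}" by blast
  then have eq: "(*\<^sub>R) s ` unit_cube x =
      cbox (s *\<^sub>R (embed x + (\<chi> i. - (1/2)))) (s *\<^sub>R (embed x + (\<chi> i. 1/2)))" (is "_ = cbox ?a ?b")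
    using assms unfolding unit_cube_cbox by (simp add: image_smult_cbox)
  show "(*\<^sub>R) s ` unit_cube x \<in> sets lebesgue" unfolding eq by simp
  have "(?b - ?a) \<bullet> axis i 1 = s" for i
    by (simp add: inner_axis algebra_simps)
  then have 1: "(?b - ?a) \<bullet> v = s" if "v \<in> Basis" for v using that by (auto simp: Basis_vec_def)
  have 2: "?a \<bullet> v \<le> ?b \<bullet> v" if "v \<in> Basis" for v using 1[OF that] assms unfolding inner_diff_left by linarith
  have "emeasure lebesgue (cbox ?a ?b) = emeasure lborel (cbox ?a ?b)" by simp
  also have "\<dots> = ennreal (\<Prod>v\<in>Basis. (?b - ?a) \<bullet> v)"
    using 2 by (subst emeasure_lborel_cbox) auto
  also have "(\<Prod>v\<in>Basis. (?b - ?a) \<bullet> v) = s ^ CARD('d)" using 1 by simp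
  finally show "emeasure lebesgue ((*\<^sub>R) s ` unit_cube x) = ennreal (s ^ CARD('d))" unfolding eq .
qed

lemma unit_cube_measure:
  fixes x :: "int ^ 'd::finite"
  shows "unit_cube x \<in> sets lebesgue" "emeasure lebesgue (unit_cube x) = 1"
  using scaled_cube_measure[of 1 x] by simp_all

text \<open>The quotient tends to 1 as K grows. Its power d/2 bounds the ratio of
  \<open>p0 * card Q\<close> to the continuum value r^(-d), with s = sqrt d accounting for the cubes
  at the rim of \<open>Q\<close>.\<close>

lemma smoothing_scale:
  fixes b s \<eta> :: real
  assumes b0: "b \<ge> 0" and \<eta>: "0 < \<eta>" "\<eta> < 1"
  obtains K where "K \<ge> 0" "b < K\<^sup>2" "(K + 1 + s)\<^sup>2 / (K\<^sup>2 - b) \<le> 1 / \<eta>"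
proof -
  let ?s = "1 + s" and b = b
  have "((\<lambda>K. (1 + ?s * inverse K)\<^sup>2 / (1 - b * (inverse K)\<^sup>2)) \<longlongrightarrow> (1 + ?s * 0)\<^sup>2 / (1 - b * 0\<^sup>2)) at_top"
    by (intro tendsto_intros tendsto_inverse_0_at_top filterlim_ident) auto
  then have "eventually (\<lambda>K. (1 + ?s * inverse K)\<^sup>2 / (1 - b * (inverse K)\<^sup>2) < 1 / \<eta>) at_top"
    by (rule order_tendstoD) (use \<eta> in auto)
  moreover have "eventually (\<lambda>K :: real. K > 0) at_top" by (rule eventually_gt_at_top)
  moreover have "eventually (\<lambda>K :: real. K > sqrt b) at_top" by (rule eventually_gt_at_top)
  ultimately have "eventually (\<lambda>K. K > 0 \<and> K > sqrt b \<and> (1 + ?s * inverse K)\<^sup>2 / (1 - b * (inverse K)\<^sup>2) < 1 / \<eta>) at_top"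
    by eventually_elim auto
  then obtain K where K: "K > 0" "K > sqrt b" "(1 + ?s * inverse K)\<^sup>2 / (1 - b * (inverse K)\<^sup>2) < 1 / \<eta>"
    using eventually_happens trivial_limit_at_top_linorder by blast
  have b: "b < K\<^sup>2"
  proof -
    have "b = (sqrt b)\<^sup>2" using b0 by simp
    also have "\<dots> < K\<^sup>2" using K(2) b0 by (intro power_strict_mono) auto
    finally show ?thesis .
  qed
  have "(K + ?s)\<^sup>2 = K\<^sup>2 * (1 + ?s * inverse K)\<^sup>2" using K(1) by (simp add: power_mult_distrib[symmetric] field_simps)
  moreover have "K\<^sup>2 - b = K\<^sup>2 * (1 - b * (inverse K)\<^sup>2)" using K(1) by (simp add: field_simps)
  ultimately have "(K + ?s)\<^sup>2 / (K\<^sup>2 - b) = (1 + ?s * inverse K)\<^sup>2 / (1 - b * (inverse K)\<^sup>2)"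
    using K(1) by simp
  then have "(K + 1 + s)\<^sup>2 / (K\<^sup>2 - b) \<le> 1 / \<eta>" using K(3) by (simp add: add.assoc)
  with K(1) b show ?thesis using that[of K] by simp
qed

lemma powr_at_top:
  assumes "(p :: real) > 0"
  shows "filterlim (\<lambda>x. x powr p) at_top at_top"
  unfolding filterlim_at_top
proof
  fix Z :: real
  have "eventually (\<lambda>x. x \<ge> (max Z 1) powr (1 / p)) at_top" by (rule eventually_ge_at_top)
  then show "eventually (\<lambda>x. Z \<le> x powr p) at_top"
  proof eventually_elim
    case (elim x)
    have "Z \<le> ((max Z 1) powr (1 / p)) powr p" using assms by (simp add: powr_powr)
    also have "\<dots> \<le> x powr p" using elim assms by (intro powr_mono2) auto
    finally show ?case .
  qed
qed

text \<open>The linear gain of \<open>profile_drop\<close> outgrows the square-root boundary error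
  of \<open>smoothed_lower_bound\<close>.\<close>

lemma superlinear_eventually:
  assumes "(c :: real) > 0" "\<sigma> > 0"
  shows "eventually (\<lambda>t. C < \<sigma> * (t * c - (2 * sqrt t + 1))) at_top"
proof -
  have "eventually (\<lambda>t. t \<ge> max ((4 / c)\<^sup>2) (2 / c * (C / \<sigma> + 2))) at_top" by (rule eventually_ge_at_top)
  then show ?thesis
  proof eventually_elim
    case (elim t)
    have t0: "t \<ge> 0" using elim zero_le_power2[of "4 / c"] by linarith
    have "4 / c = sqrt ((4 / c)\<^sup>2)" using assms by simp
    also have "\<dots> \<le> sqrt t" using elim by (intro real_sqrt_le_mono) auto
    finally have "2 \<le> c / 2 * sqrt t" using assms by (simp add: field_simps)
    then have "2 * sqrt t \<le> c / 2 * sqrt t * sqrt t" using t0 by (intro mult_right_mono) auto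
    then have 1: "2 * sqrt t \<le> c / 2 * t" using t0 by (simp add: mult.assoc)
    have "c / 2 * (2 / c * (C / \<sigma> + 2)) \<le> c / 2 * t" using elim assms by (intro mult_left_mono) auto
    then have "C / \<sigma> + 2 \<le> c / 2 * t" using assms by simp
    moreover have "t * c = c / 2 * t + c / 2 * t" by simp
    ultimately have "C / \<sigma> < t * c - (2 * sqrt t + 1)" using 1 by linarith
    then show ?case using assms by (simp add: field_simps)
  qed
qed

section \<open>Estimates relative to the radius r of the ball of unit volume\<close>

context
  fixes r :: real
  assumes unit_ball: "emeasure lebesgue (ball (0 :: real ^ 'd::finite) r) = 1"
begin

lemma radius_pos: "r > 0"
proof (rule ccontr)
  assume "\<not> r > 0"
  then have "ball (0 :: real ^ 'd) r = {}" by simp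
  then show False using unit_ball by (simp only: emeasure_empty) simp
qed

lemma ball_measure:
  assumes "L \<ge> 0"
  shows "emeasure lebesgue (ball (0 :: real ^ 'd) L) = ennreal ((L / r) ^ CARD('d))"
proof -
  have *: "emeasure lebesgue (ball (0 :: real ^ 'd) L) = ennreal (unit_ball_vol (real CARD('d)) * L ^ CARD('d))"
    if "L \<ge> 0" for L using that by (simp add: emeasure_ball)
  have "ennreal (unit_ball_vol (real CARD('d)) * r ^ CARD('d)) = 1"
    using *[of r] radius_pos unit_ball by simp
  then have "unit_ball_vol (real CARD('d)) * r ^ CARD('d) = 1"
    by (simp add: ennreal_eq_1)
  then have "unit_ball_vol (real CARD('d)) = 1 / r ^ CARD('d)" using radius_pos by (simp add: field_simps)
  then show ?thesis using *[OF assms] by (simp add: power_divide)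
qed

text \<open>The open unit cubes about lattice points are disjoint and pack into a slightly larger
  ball; for the reverse bound \<open>card_lattice_ball_ge\<close>, the closed cubes cover a slightly
  smaller one.\<close>

lemma card_lattice_ball_le:
  fixes F :: "(int ^ 'd) set"
  assumes "finite F" "\<And>x. x \<in> F \<Longrightarrow> norm (embed x) \<le> L" "L \<ge> 0"
  shows "real (card F) \<le> ((L + sqrt (real CARD('d))) / r) ^ CARD('d)"
proof -
  let ?box = "\<lambda>x :: int ^ 'd. box (embed x + (\<chi> i. - (1/2))) (embed x + (\<chi> i. 1/2))"
  have mem: "z \<in> ?box x \<longleftrightarrow> (\<forall>i. \<bar>z $ i - real_of_int (x $ i)\<bar> < 1 / 2)" for z x
  proof -
    have "b + - (1/2) < a \<and> a < b + 1/2 \<longleftrightarrow> \<bar>a - b\<bar> < 1/2" for a b :: real by linarith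
    then show ?thesis by (simp only: mem_box_cart embed_def vec_lambda_beta vector_add_component)
  qed
  have "disjoint_family_on ?box F"
    unfolding disjoint_family_on_def
  proof (intro ballI impI)
    fix x y :: "int ^ 'd" assume "x \<noteq> y"
    then obtain i where "x $ i \<noteq> y $ i" by (auto simp: vec_eq_iff)
    then have "\<bar>real_of_int (x $ i) - real_of_int (y $ i)\<bar> \<ge> 1" by linarith
    then have "False" if "\<bar>t - real_of_int (x $ i)\<bar> < 1 / 2" "\<bar>t - real_of_int (y $ i)\<bar> < 1 / 2" for t
      using that by linarith
    then show "?box x \<inter> ?box y = {}" unfolding disjoint_iff mem by blast
  qed
  then have "(\<Sum>x\<in>F. emeasure lborel (?box x)) = emeasure lborel (\<Union>x\<in>F. ?box x)"
    using assms(1) by (intro sum_emeasure) auto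
  moreover have "emeasure lborel (?box x) = 1" for x
  proof -
    have *: "(embed x + (\<chi> i. 1/2) - (embed x + (\<chi> i. - (1/2)))) \<bullet> v = (1::real)" if "v \<in> Basis" for v
      using that by (auto simp: Basis_vec_def inner_axis)
    show ?thesis using * by (subst emeasure_lborel_box) (auto simp: inner_diff_left algebra_simps)
  qed
  moreover have "(\<Union>x\<in>F. ?box x) \<subseteq> ball 0 (L + sqrt (real CARD('d)))"
  proof safe
    fix x z assume x: "x \<in> F" and z: "z \<in> ?box x"
    have "norm (2 *\<^sub>R (z - embed x)) \<le> sqrt (real CARD('d))"
    proof (rule norm_le_sqrt_card)
      fix i
      have "\<bar>z $ i - real_of_int (x $ i)\<bar> < 1 / 2" using z by (simp only: mem)
      then have "\<bar>2 * (z $ i - real_of_int (x $ i))\<bar> \<le> 1" by (simp only: abs_mult) simp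
      moreover have "(2 *\<^sub>R (z - embed x)) $ i = 2 * (z $ i - real_of_int (x $ i))" by (simp add: embed_def)
      ultimately show "\<bar>(2 *\<^sub>R (z - embed x)) $ i\<bar> \<le> 1" by (simp only:)
    qed
    moreover have "sqrt (real CARD('d)) > 0" by simp
    moreover have "norm z \<le> norm (embed x) + norm (z - embed x)" by (metis norm_triangle_sub)
    ultimately show "z \<in> ball 0 (L + sqrt (real CARD('d)))" using assms(2)[OF x] unfolding mem_ball_0 norm_scaleR by linarith
  qed
  then have "emeasure lborel (\<Union>x\<in>F. ?box x) \<le> emeasure lborel (ball (0 :: real ^ 'd) (L + sqrt (real CARD('d))))"
    by (intro emeasure_mono) auto
  ultimately have "of_nat (card F) \<le> emeasure lebesgue (ball (0 :: real ^ 'd) (L + sqrt (real CARD('d))))"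
    by simp
  then have "ennreal (real (card F)) \<le> ennreal (((L + sqrt (real CARD('d))) / r) ^ CARD('d))"
    using assms(3) by (subst (asm) ball_measure) (auto simp: ennreal_of_nat_eq_real_of_nat)
  then show ?thesis using assms(3) radius_pos by (subst (asm) ennreal_le_iff) auto
qed

lemma ball_subset_cubes:
  assumes "norm (z :: real ^ 'd) \<le> L - sqrt (real CARD('d))"
  obtains x where "norm (embed x) \<le> L" "z \<in> unit_cube x"
proof -
  obtain x where x: "z \<in> unit_cube x" by (rule unit_cube_cover)
  have "norm (embed x) \<le> norm z + norm (z - embed x)" by (metis norm_minus_commute norm_triangle_sub)
  then have "norm (embed x) \<le> L" using norm_unit_cube[OF x] assms by linarith
  with x show ?thesis using that by blast
qed

lemma card_lattice_ball_ge:
  assumes "L \<ge> sqrt (real CARD('d))"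
  shows "((L - sqrt (real CARD('d))) / r) ^ CARD('d) \<le> real (card {x :: int ^ 'd. norm (embed x) \<le> L})"
proof -
  let ?G = "{x :: int ^ 'd. norm (embed x) \<le> L}"
  have "ball (0 :: real ^ 'd) (L - sqrt (real CARD('d))) \<subseteq> (\<Union>x\<in>?G. unit_cube x)"
  proof
    fix z :: "real ^ 'd" assume "z \<in> ball 0 (L - sqrt (real CARD('d)))"
    then have "norm z \<le> L - sqrt (real CARD('d))" by simp
    then show "z \<in> (\<Union>x\<in>?G. unit_cube x)" by (rule ball_subset_cubes) auto
  qed
  then have "emeasure lebesgue (ball (0 :: real ^ 'd) (L - sqrt (real CARD('d)))) \<le> emeasure lebesgue (\<Union>x\<in>?G. unit_cube x)"
    by (intro emeasure_mono sets.finite_UN finite_norm_embed unit_cube_measure)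
  also have "\<dots> \<le> (\<Sum>x\<in>?G. emeasure lebesgue (unit_cube x))"
    using unit_cube_measure(1) by (intro emeasure_subadditive_finite finite_norm_embed) auto
  also have "\<dots> = ennreal (real (card ?G))" by (simp add: unit_cube_measure ennreal_of_nat_eq_real_of_nat)
  finally show ?thesis using assms by (subst (asm) ball_measure) auto
qed

text \<open>The function u is quantified inside \<open>eventually\<close>: the threshold for n is
  uniform in u, because the toppling function changes with n and with the initial
  directions.\<close>

lemma eventually_positive_on_ball:
  assumes \<eta>: "0 < \<eta>" "\<eta> < 1" and a: "a > 0"
  shows "eventually (\<lambda>n :: nat. \<forall>u :: int ^ 'd \<Rightarrow> real.
      (\<forall>x. u x \<ge> 0) \<longrightarrow> (\<forall>x. lap u x \<le> 2 * real CARD('d) * (a - (if x = 0 then real n else 0))) \<longrightarrow>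
      (\<forall>x. norm (embed x) \<le> \<eta> * r * (real n / a) powr (1 / real CARD('d)) \<longrightarrow> u x > 0)) sequentially"
proof -
  let ?d = "real CARD('d)" and ?b = "shift (CARD('d))"
  note r = radius_pos
  obtain K where K: "K \<ge> 0" "?b < K\<^sup>2" and K\<eta>: "(K + 1 + sqrt ?d)\<^sup>2 / (K\<^sup>2 - ?b) \<le> 1 / \<eta>"
    by (rule smoothing_scale[where b = ?b and s = "sqrt ?d", OF _ \<eta>]) (simp add: shift_def)
  obtain \<psi> where \<psi>: "\<And>t. t > -1 \<Longrightarrow> (\<psi> has_real_derivative - profile (CARD('d)) (K\<^sup>2) t) (at t)"
    using profile_antiderivative[OF K(2)] by blast
  define Q where "Q = {y :: int ^ 'd. norm (embed y) \<le> K + 1}"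
  have finQ: "finite Q" by (simp add: Q_def finite_norm_embed)
  define p0 where "p0 = (K\<^sup>2 - ?b) powr (- ?d / 2)"
  define \<theta>' where "\<theta>' = (1 + \<eta>) / 2"
  have \<theta>': "0 < \<theta>'" "\<theta>' < 1" "\<eta> < \<theta>'" using \<eta> by (auto simp: \<theta>'_def)
  define gain where "gain = (\<theta>' - \<eta>) * (\<theta>' powr (- ?d / 2) - 1)"
  have "1 powr (- ?d / 2) < \<theta>' powr (- ?d / 2)" using \<theta>' by (intro powr_less_mono2_neg) auto
  then have gain: "gain > 0" using \<theta>' by (simp add: gain_def)
  define \<sigma> where "\<sigma> = a * (\<eta> * r\<^sup>2) powr (- ?d / 2)"
  have \<sigma>: "\<sigma> > 0" using a \<eta> r by (simp add: \<sigma>_def)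
  obtain l where l: "\<And>y. y \<in> Q \<Longrightarrow> l1 y \<le> l"
    using finite_nat_set_iff_bounded_le[of "l1 ` Q"] finQ by auto
  define M where "M = harnack_bound (2 * ?d) a l"
  \<comment> \<open>The value that the weighted sum over \<open>Q\<close> cannot exceed when u
    vanishes at the centre.\<close>
  define C where "C = p0 * (real (card Q) * M)"
  \<comment> \<open>Chosen so that \<kappa> = (u1 n)^(-d/2) equals \<sigma> / n: the product n
    \<kappa> no longer depends on n.\<close>
  define u1 where "u1 n = \<eta> * r\<^sup>2 * (real n / a) powr (2 / ?d)" for n :: nat
  \<comment> \<open>The mass condition required by \<open>smoothed_lower_bound\<close>. The factor
    \<eta> inside \<sigma> is the room for the excess of \<open>p0 * card Q\<close>.\<close>
  have mass: "a * p0 * real (card Q) \<le> \<sigma>"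
  proof -
    have "real (card Q) \<le> ((K + 1 + sqrt ?d) / r) ^ CARD('d)"
      using finQ K by (intro card_lattice_ball_le) (auto simp: Q_def)
    also have "\<dots> = ((K + 1 + sqrt ?d)\<^sup>2 / r\<^sup>2) powr (?d / 2)"
    proof -
      have Y: "(K + 1 + sqrt ?d) / r > 0" (is "?Y > 0") using K r by (simp add: add_nonneg_pos)
      have "?Y ^ CARD('d) = ?Y powr ?d" using Y by (simp add: powr_realpow)
      also have "\<dots> = (?Y powr 2) powr (?d / 2)" by (simp add: powr_powr)
      also have "?Y powr 2 = ?Y\<^sup>2" using Y by simp
      finally show ?thesis by (simp only: power_divide)
    qed
    finally have "p0 * real (card Q) \<le> p0 * ((K + 1 + sqrt ?d)\<^sup>2 / r\<^sup>2) powr (?d / 2)"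
      by (intro mult_left_mono) (auto simp: p0_def)
    also have "\<dots> = ((K + 1 + sqrt ?d)\<^sup>2 / (K\<^sup>2 - ?b) / r\<^sup>2) powr (?d / 2)"
    proof -
      have 1: "p0 = inverse ((K\<^sup>2 - ?b) powr (?d / 2))"
        by (simp only: p0_def powr_minus minus_divide_left[symmetric])
      have 2: "((K + 1 + sqrt ?d)\<^sup>2 / r\<^sup>2 / (K\<^sup>2 - ?b)) powr (?d / 2) =
          ((K + 1 + sqrt ?d)\<^sup>2 / r\<^sup>2) powr (?d / 2) / (K\<^sup>2 - ?b) powr (?d / 2)"
        by (rule powr_divide)
      have "(K + 1 + sqrt ?d)\<^sup>2 / (K\<^sup>2 - ?b) / r\<^sup>2 = (K + 1 + sqrt ?d)\<^sup>2 / r\<^sup>2 / (K\<^sup>2 - ?b)"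
        by (simp only: divide_divide_eq_left mult.commute)
      moreover have "inverse x * y = y / x" for x y :: real by (simp add: divide_inverse mult.commute)
      ultimately show ?thesis by (simp only: 1 2)
    qed
    also have "\<dots> \<le> (1 / \<eta> / r\<^sup>2) powr (?d / 2)"
      using K\<eta> K r by (intro powr_mono2 divide_right_mono) auto
    also have "\<dots> = (\<eta> * r\<^sup>2) powr (- ?d / 2)"
    proof -
      have "1 / \<eta> / r\<^sup>2 = inverse (\<eta> * r\<^sup>2)" by (simp add: divide_inverse)
      moreover have "(inverse (\<eta> * r\<^sup>2)) powr (?d / 2) = inverse ((\<eta> * r\<^sup>2) powr (?d / 2))"
        by (rule inverse_powr)
      ultimately show ?thesis by (simp only: powr_minus minus_divide_left[symmetric])
    qed
    finally show ?thesis using a by (simp add: \<sigma>_def mult.assoc)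
  qed
  have u1_top: "filterlim (\<lambda>n. ?b + u1 n) at_top sequentially"
  proof -
    have "filterlim (\<lambda>n. real n / a) at_top sequentially"
      using a filterlim_real_sequentially by (intro filterlim_tendsto_pos_mult_at_top[where f = "\<lambda>_. 1 / a" and c = "1 / a" and g = real, simplified]) auto
    then have "filterlim (\<lambda>n. (real n / a) powr (2 / ?d)) at_top sequentially"
      by (rule filterlim_compose[OF powr_at_top, rotated]) auto
    then have "filterlim u1 at_top sequentially"
      unfolding u1_def using \<eta> r by (intro filterlim_tendsto_pos_mult_at_top[OF tendsto_const]) auto
    then show ?thesis by (intro filterlim_tendsto_add_at_top[OF tendsto_const])
  qed
  have "eventually (\<lambda>t. C < \<sigma> * (t * gain - (2 * sqrt t + 1)) \<and> K\<^sup>2 / \<theta>' \<le> t) at_top"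
    by (intro eventually_conj superlinear_eventually gain \<sigma> eventually_ge_at_top)
  with u1_top have "eventually (\<lambda>n. C < \<sigma> * ((?b + u1 n) * gain - (2 * sqrt (?b + u1 n) + 1)) \<and> K\<^sup>2 / \<theta>' \<le> ?b + u1 n) sequentially"
    by (rule eventually_compose_filterlim[rotated])
  moreover have "eventually (\<lambda>n :: nat. n > 0) sequentially" by (rule eventually_gt_at_top)
  ultimately show ?thesis
  proof eventually_elim
    case (elim n)
    define t1 where "t1 = ?b + u1 n"
    define \<kappa> where "\<kappa> = (t1 - ?b) powr (- ?d / 2)"
    have b: "?b > 0" by (simp add: shift_def add_pos_pos)
    have K\<theta>': "K\<^sup>2 \<le> \<theta>' * t1"
      using elim \<theta>'(1) by (simp add: t1_def pos_divide_le_eq mult.commute)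
    have u1: "u1 n > 0" using elim a \<eta> r by (simp add: u1_def)
    have t1: "t1 > 0" using b u1 by (simp add: t1_def)
    have n\<kappa>: "real n * \<kappa> = \<sigma>"
    proof -
      have "\<kappa> = (\<eta> * r\<^sup>2) powr (- ?d / 2) * ((real n / a) powr (2 / ?d)) powr (- ?d / 2)"
        using \<eta> r unfolding \<kappa>_def t1_def u1_def by (simp add: powr_mult)
      also have "((real n / a) powr (2 / ?d)) powr (- ?d / 2) = (real n / a) powr (- 1)"
        by (simp add: powr_powr)
      also have "\<dots> = a / real n" using elim a by (simp add: powr_minus)
      finally show ?thesis using elim by (simp add: \<sigma>_def)
    qed
    show ?case
    proof (intro allI impI)
      fix u :: "int ^ 'd \<Rightarrow> real" and x :: "int ^ 'd"
      assume nonneg: "\<forall>x. u x \<ge> 0"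
        and lap: "\<forall>x. lap u x \<le> 2 * ?d * (a - (if x = 0 then real n else 0))"
        and x: "norm (embed x) \<le> \<eta> * r * (real n / a) powr (1 / ?d)"
      have "sqn x \<le> (\<eta> * r * (real n / a) powr (1 / ?d))\<^sup>2"
        unfolding sqn_def using x by (intro power_mono) auto
      also have "\<dots> = \<eta> * u1 n"
      proof -
        have "((real n / a) powr (1 / ?d))\<^sup>2 = (real n / a) powr (2 / ?d)"
          by (simp add: power2_eq_square powr_add[symmetric])
        then show ?thesis by (simp add: u1_def power_mult_distrib power2_eq_square)
      qed
      also have "\<dots> \<le> \<eta> * t1" using b \<eta> by (simp add: t1_def)
      finally have sqn: "sqn x \<le> \<eta> * t1" .
      also have "\<dots> < t1" using \<eta> t1 by simp
      finally have sqn': "sqn x < t1" .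
      have "real n * (\<kappa> * t1 * gain - \<kappa> * (2 * sqrt t1 + 1)) \<le>
          real n * (\<psi> (sqn x) - \<psi> t1 + \<kappa> * (sqn x - t1) - \<kappa> * (2 * sqrt t1 + 1))"
        unfolding gain_def using K\<theta>' sqn
        by (intro mult_left_mono diff_right_mono profile_drop[OF K(2) \<psi> \<eta> \<theta>'_def])
          (simp_all add: \<kappa>_def)
      also have "\<dots> \<le> p0 * (\<Sum>y\<in>Q. u (x + y))"
        unfolding p0_def Q_def using nonneg lap sqn' t1 mass n\<kappa>
        by (intro smoothed_lower_bound[OF K \<psi>, where a = a]) (auto simp: \<kappa>_def p0_def Q_def)
      finally have "\<sigma> * (t1 * gain - (2 * sqrt t1 + 1)) \<le> p0 * (\<Sum>y\<in>Q. u (x + y))"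
        unfolding n\<kappa>[symmetric] by (simp add: algebra_simps)
      moreover have "C < \<sigma> * (t1 * gain - (2 * sqrt t1 + 1))" using elim by (simp add: t1_def)
      ultimately have big: "C < p0 * (\<Sum>y\<in>Q. u (x + y))" by linarith
      show "u x > 0"
      proof (rule ccontr)
        assume "\<not> u x > 0"
        then have zero: "u x = 0" using nonneg by (metis antisym_conv2)
        \<comment> \<open>Dropping the source leaves the constant a alone; therefore M and C do not
          depend on n.\<close>
        have lap': "lap u x \<le> 2 * ?d * a" for x
        proof -
          have "2 * ?d * (a - (if x = 0 then real n else 0)) \<le> 2 * ?d * a"
            by (intro mult_left_mono) auto
          then show ?thesis using lap order_trans by blast
        qed
        have "u (x + y) \<le> M" if "y \<in> Q" for y
        proof -
          have "u (x + y) \<le> harnack_bound (2 * ?d) a (l1 y)"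
            using nonneg lap' zero by (intro crude_harnack) auto
          also have "\<dots> \<le> M"
            unfolding M_def using l[OF that] a zero_less_card_finite[where 'a = 'd]
            by (intro harnack_bound_mono[THEN conjunct2]) (auto simp del: zero_less_card_finite)
          finally show ?thesis .
        qed
        then have "(\<Sum>y\<in>Q. u (x + y)) \<le> real (card Q) * M" by (rule sum_bounded_above)
        then have "p0 * (\<Sum>y\<in>Q. u (x + y)) \<le> C"
          unfolding C_def by (intro mult_left_mono) (auto simp: p0_def)
        then show False using big by simp
      qed
    qed
  qed
qed

text \<open>Let q = 1 - \<eta>^(3d). The lattice ball \<open>G\<close> has at least (1 - q) \<rho>^d
  sites and A at most (1 + q) \<rho>^d, so A - G has at most 2q \<rho>^d. The far sites
  \<open>P\<close> of V lie in A - G or next to it, hence number at most 2d + 1 times as many. With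
  a shell of volume q inside the ball the total is (2d + 1) 2q + q = (4d + 3) q.\<close>

lemma cluster_estimate:
  fixes A V :: "(int ^ 'd) set"
  assumes \<eta>: "0 < \<eta>" "\<eta> < 1" and \<rho>: "\<rho> > 0"
    and ball: "\<And>x. norm (embed x) \<le> \<eta>\<^sup>2 * (r * \<rho>) \<Longrightarrow> x \<in> A"
    and AV: "A \<subseteq> V" and finA: "finite A" 
    and cardA: "real (card A) \<le> \<rho> ^ CARD('d) * (2 - \<eta> ^ (3 * CARD('d)))"
    and boundary: "\<And>x. x \<in> V - A \<Longrightarrow> x \<noteq> 0 \<Longrightarrow> \<exists>v\<in>units. x + v \<in> A"
    and L: "\<eta> ^ 3 * (r * \<rho>) \<le> \<eta>\<^sup>2 * (r * \<rho>) - sqrt (real CARD('d))"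
      "\<eta>\<^sup>2 * (r * \<rho>) + 1 + sqrt (real CARD('d)) < r * \<rho>"
  shows "emeasure lebesgue (sym_diff ((*\<^sub>R) (1 / \<rho>) ` (\<Union>x\<in>V. unit_cube x)) (ball (0 :: real ^ 'd) r))
    \<le> ennreal ((4 * real CARD('d) + 3) * (1 - \<eta> ^ (3 * CARD('d))))"
proof -
  let ?d = "CARD('d)"
  define L where "L = \<eta>\<^sup>2 * (r * \<rho>)"
  define s where "s = 1 / \<rho>"
  define G where "G = {x :: int ^ 'd. norm (embed x) \<le> L}"
  \<comment> \<open>Beyond L + 1 every neighbour is still outside \<open>G\<close>, so a toppled
    neighbour lies in A - G. Cubes of V that reach outside the scaled ball have their centres in
    \<open>P\<close>, by the second gap condition.\<close>
  define P where "P = {x \<in> V. norm (embed x) > L + 1}"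
  define q where "q = 1 - \<eta> ^ (3 * ?d)"
  have s: "s > 0" using \<rho> by (simp add: s_def)
  note r = radius_pos
  have GA: "G \<subseteq> A" using ball by (auto simp: G_def L_def)
  have "\<eta> ^ (3 * ?d) \<le> 1" using \<eta> by (intro power_le_one) auto
  then have q: "q \<ge> 0" by (simp add: q_def)
  have "\<eta> ^ 3 * (r * \<rho>) \<ge> 0" using \<eta> r \<rho> by simp
  then have Lpos: "sqrt (real ?d) \<le> L" using L(1) unfolding L_def by linarith
  then have "L \<ge> 0" using order_trans[OF real_sqrt_ge_zero, of "real ?d" L] by simp
  have "\<eta> ^ (3 * ?d) * \<rho> ^ ?d = (\<eta> ^ 3 * (r * \<rho>) / r) ^ ?d"
    using r by (simp add: power_mult power_mult_distrib)
  also have "\<dots> \<le> ((L - sqrt (real ?d)) / r) ^ ?d"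
    using L(1) \<eta> r \<rho> by (intro power_mono divide_right_mono) (auto simp: L_def)
  also have "\<dots> \<le> real (card G)"
    unfolding G_def by (rule card_lattice_ball_ge[OF Lpos])
  finally have cardG: "\<eta> ^ (3 * ?d) * \<rho> ^ ?d \<le> real (card G)" .
  have finG: "finite G" by (simp add: G_def finite_norm_embed)
  have "real (card (A - G)) = real (card A) - real (card G)"
    using card_Diff_subset[OF finG GA] card_mono[OF finA GA] by simp
  also have "\<dots> \<le> \<rho> ^ ?d * (2 - \<eta> ^ (3 * ?d)) - \<eta> ^ (3 * ?d) * \<rho> ^ ?d"
    using cardA cardG by linarith
  also have "\<dots> = \<rho> ^ ?d * (2 * q)" by (simp add: q_def algebra_simps)
  finally have cardAG: "real (card (A - G)) \<le> \<rho> ^ ?d * (2 * q)" .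
  have P_sub: "P \<subseteq> (A - G) \<union> (\<Union>v\<in>units. (\<lambda>x. x - v) ` (A - G))"
  proof
    fix x assume x: "x \<in> P"
    show "x \<in> (A - G) \<union> (\<Union>v\<in>units. (\<lambda>x. x - v) ` (A - G))"
    proof (cases "x \<in> A")
      case True
      then show ?thesis using x by (auto simp: P_def G_def)
    next
      case False
      have "x \<noteq> 0" using x \<open>L \<ge> 0\<close> by (auto simp: P_def)
      then obtain v where v: "v \<in> units" "x + v \<in> A" using boundary[of x] x False by (auto simp: P_def)
      have "norm (embed x) \<le> norm (embed (x + v)) + norm (embed v)"
        unfolding embed_add by (metis add_diff_cancel_right' norm_triangle_ineq4)
      then have "x + v \<notin> G" using x norm_embed_unit[OF v(1)] by (auto simp: P_def G_def)
      then have "x \<in> (\<lambda>x. x - v) ` (A - G)" using v by (intro image_eqI[of _ _ "x + v"]) auto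
      then show ?thesis using v by blast
    qed
  qed
  have finAG: "finite (A - G)" using finA by simp
  have finP: "finite P" using finite_subset[OF P_sub] finAG by auto
  have "card P \<le> card ((A - G) \<union> (\<Union>v\<in>units. (\<lambda>x. x - v) ` (A - G)))"
    using P_sub finAG by (intro card_mono) auto
  also have "\<dots> \<le> card (A - G) + card (\<Union>v\<in>units. (\<lambda>x. x - v) ` (A - G))" by (rule card_Un_le)
  also have "card (\<Union>v\<in>units. (\<lambda>x. x - v) ` (A - G)) \<le> (\<Sum>v\<in>(units :: (int ^ 'd) set). card ((\<lambda>x. x - v) ` (A - G)))"
    by (rule card_UN_le) simp
  also have "\<dots> \<le> (\<Sum>v\<in>(units :: (int ^ 'd) set). card (A - G))"
    using finAG by (intro sum_mono card_image_le)
  finally have "card P \<le> (2 * ?d + 1) * card (A - G)" by (simp add: card_units)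
  then have "real (card P) \<le> real ((2 * ?d + 1) * card (A - G))" by (rule of_nat_mono)
  also have "\<dots> = (2 * real ?d + 1) * real (card (A - G))" by (simp add: algebra_simps)
  also have "\<dots> \<le> (2 * real ?d + 1) * (\<rho> ^ ?d * (2 * q))"
    using cardAG by (intro mult_left_mono) auto
  finally have cardP: "real (card P) \<le> (2 * real ?d + 1) * (\<rho> ^ ?d * (2 * q))" .
  have sub: "sym_diff ((*\<^sub>R) s ` (\<Union>x\<in>V. unit_cube x)) (ball (0 :: real ^ 'd) r) \<subseteq>
     (\<Union>x\<in>P. (*\<^sub>R) s ` unit_cube x) \<union> (ball 0 r - ball 0 (\<eta> ^ 3 * r))"
  proof
    fix z assume "z \<in> sym_diff ((*\<^sub>R) s ` (\<Union>x\<in>V. unit_cube x)) (ball (0 :: real ^ 'd) r)"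
    then consider (out) x y where "x \<in> V" "y \<in> unit_cube x" "z = s *\<^sub>R y" "norm z \<ge> r"
      | (inn) "norm z < r" "z \<notin> (*\<^sub>R) s ` (\<Union>x\<in>V. unit_cube x)"
      by (auto simp: not_less)
    then show "z \<in> (\<Union>x\<in>P. (*\<^sub>R) s ` unit_cube x) \<union> (ball 0 r - ball 0 (\<eta> ^ 3 * r))"
    proof cases
      case out
      have "r * \<rho> \<le> norm y" using out s \<rho> by (simp add: s_def field_simps)
      also have "\<dots> \<le> norm (embed x) + norm (y - embed x)" by (metis norm_triangle_sub)
      also have "\<dots> \<le> norm (embed x) + sqrt (real ?d)" using norm_unit_cube[OF out(2)] by simp
      finally have "x \<in> P" using L(2) out(1) by (simp add: P_def L_def)
      then show ?thesis using out by blast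
    next
      case inn
      have "\<not> norm z < \<eta> ^ 3 * r"
      proof
        assume z: "norm z < \<eta> ^ 3 * r"
        have "norm (\<rho> *\<^sub>R z) = \<rho> * norm z" using \<rho> by simp
        also have "\<dots> \<le> \<rho> * (\<eta> ^ 3 * r)" using z \<rho> by (intro mult_left_mono) auto
        also have "\<dots> \<le> L - sqrt (real ?d)" using L(1) by (simp add: L_def mult.commute mult.left_commute)
        finally obtain x where x: "norm (embed x) \<le> L" "\<rho> *\<^sub>R z \<in> unit_cube x" by (rule ball_subset_cubes)
        have "x \<in> V" using x(1) GA AV by (auto simp: G_def)
        moreover have "z = s *\<^sub>R (\<rho> *\<^sub>R z)" using \<rho> by (simp add: s_def)
        ultimately show False using inn(2) x(2) by blast
      qed
      then show ?thesis using inn(1) by simp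
    qed
  qed
  have meas: "(\<Union>x\<in>P. (*\<^sub>R) s ` unit_cube x) \<in> sets lebesgue"
    using finP s by (intro sets.finite_UN scaled_cube_measure)
  have "emeasure lebesgue (\<Union>x\<in>P. (*\<^sub>R) s ` unit_cube x) \<le> (\<Sum>x\<in>P. emeasure lebesgue ((*\<^sub>R) s ` unit_cube x))"
    using finP s scaled_cube_measure(1) by (intro emeasure_subadditive_finite) blast+
  also have "\<dots> = ennreal (real (card P) * s ^ ?d)"
    unfolding scaled_cube_measure(2)[OF s] using s
    by (simp add: ennreal_mult ennreal_of_nat_eq_real_of_nat)
  also have "\<dots> \<le> ennreal ((2 * real ?d + 1) * (2 * q))"
  proof (rule ennreal_leI)
    have "real (card P) * s ^ ?d \<le> (2 * real ?d + 1) * (\<rho> ^ ?d * (2 * q)) * s ^ ?d"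
      using cardP s by (intro mult_right_mono) auto
    also have "\<dots> = (2 * real ?d + 1) * (2 * q)" using \<rho> by (simp add: s_def power_one_over)
    finally show "real (card P) * s ^ ?d \<le> (2 * real ?d + 1) * (2 * q)" .
  qed
  finally have 1: "emeasure lebesgue (\<Union>x\<in>P. (*\<^sub>R) s ` unit_cube x) \<le> ennreal ((2 * real ?d + 1) * (2 * q))" .
  have "\<eta> ^ 3 * r \<le> r" using \<eta> r by (simp add: mult_left_le_one_le power_le_one)
  then have "emeasure lebesgue (ball (0 :: real ^ 'd) r - ball 0 (\<eta> ^ 3 * r)) =
      emeasure lebesgue (ball (0 :: real ^ 'd) r) - emeasure lebesgue (ball (0 :: real ^ 'd) (\<eta> ^ 3 * r))"
    using \<eta> r by (intro emeasure_Diff subset_ball) (simp_all add: emeasure_ball)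
  also have "\<dots> = 1 - ennreal (\<eta> ^ (3 * ?d))"
  proof -
    have "emeasure lebesgue (ball (0 :: real ^ 'd) (\<eta> ^ 3 * r)) = ennreal ((\<eta> ^ 3 * r / r) ^ ?d)"
      using \<eta> r by (intro ball_measure) auto
    also have "(\<eta> ^ 3 * r / r) ^ ?d = \<eta> ^ (3 * ?d)" using r by (simp add: power_mult)
    finally show ?thesis unfolding unit_ball by simp
  qed
  also have "\<dots> = ennreal q" using \<eta> by (simp add: q_def ennreal_minus flip: ennreal_1)
  finally have 2: "emeasure lebesgue (ball (0 :: real ^ 'd) r - ball 0 (\<eta> ^ 3 * r)) = ennreal q" .
  have "emeasure lebesgue (sym_diff ((*\<^sub>R) s ` (\<Union>x\<in>V. unit_cube x)) (ball (0 :: real ^ 'd) r))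
      \<le> emeasure lebesgue ((\<Union>x\<in>P. (*\<^sub>R) s ` unit_cube x) \<union> (ball 0 r - ball 0 (\<eta> ^ 3 * r)))"
    using meas by (intro emeasure_mono sub) auto
  also have "\<dots> \<le> emeasure lebesgue (\<Union>x\<in>P. (*\<^sub>R) s ` unit_cube x) +
      emeasure lebesgue (ball (0 :: real ^ 'd) r - ball 0 (\<eta> ^ 3 * r))"
    using meas by (intro emeasure_subadditive) auto
  also have "\<dots> \<le> ennreal ((2 * real ?d + 1) * (2 * q)) + ennreal q"
    using 1 2 by (intro add_mono) auto
  also have "\<dots> = ennreal ((4 * real ?d + 3) * q)"
    using q by (subst ennreal_plus[symmetric]) (auto simp: algebra_simps)
  finally show ?thesis by (simp add: s_def q_def)
qed

text \<open>The three powers of \<eta>: one from \<open>positive\<close>, one from replacing a by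
  |h| in the radius, and one to absorb the cube diameter in the first condition
  \<open>L\<close>.\<close>

lemma final_config_estimate:
  fixes e :: "nat \<Rightarrow> int ^ 'd" and D :: "int ^ 'd \<Rightarrow> nat"
  assumes enum: "unit_vector_enum e" and D: "\<And>x. D x < 2 * CARD('d)"
    and h: "h < 0" and c: "0 < c" "c \<le> 2 * CARD('d)" and n: "n > 0"
    and \<eta>: "0 < \<eta>" "\<eta> < 1"
    and \<rho>: "\<rho> = (real n / \<bar>real_of_int h\<bar>) powr (1 / real CARD('d))"
    and a: "a = \<bar>real_of_int h\<bar> + 4 * real CARD('d)" "\<eta> ^ CARD('d) * a \<le> \<bar>real_of_int h\<bar>"
    and positive: "\<forall>u :: int ^ 'd \<Rightarrow> real.
      (\<forall>x. u x \<ge> 0) \<longrightarrow> (\<forall>x. lap u x \<le> 2 * real CARD('d) * (a - (if x = 0 then real n else 0))) \<longrightarrow>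
      (\<forall>x. norm (embed x) \<le> \<eta> * r * (real n / a) powr (1 / real CARD('d)) \<longrightarrow> u x > 0)"
    and L: "\<eta> ^ 3 * (r * \<rho>) \<le> \<eta>\<^sup>2 * (r * \<rho>) - sqrt (real CARD('d))"
      "\<eta>\<^sup>2 * (r * \<rho>) + 1 + sqrt (real CARD('d)) < r * \<rho>"
    and hn: "\<bar>real_of_int h\<bar> / real n \<le> 1 - \<eta> ^ (3 * CARD('d))"
  shows "emeasure lebesgue (sym_diff ((*\<^sub>R) (1 / \<rho>) ` particle_cluster c e h n D) (ball (0 :: real ^ 'd) r))
    \<le> ennreal ((4 * real CARD('d) + 3) * (1 - \<eta> ^ (3 * CARD('d))))"
proof -
  let ?d = "CARD('d)"
  define m where "m = \<bar>real_of_int h\<bar>"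
  have m: "m > 0" "real_of_int h = - m" using h by (auto simp: m_def)
  obtain t where final: "final_config c e h n D = conf c e h n D t"
    and adm: "admissible c e h n D t" and st: "Defs.stable c (conf c e h n D t)"
    by (rule final_config_conf[where D = D, OF enum D h c(1)])
  let ?H = "particles (conf c e h n D t)"
  define A where "A = {x. t x > 0}"
  define V where "V = A \<union> {x. ?H x > h}"
  have cluster: "particle_cluster c e h n D = (\<Union>x\<in>V. unit_cube x)"
    by (auto simp: particle_cluster_def toppling_cluster_def final V_def A_def conf_def)
  have \<rho>pos: "\<rho> > 0" using n h by (simp add: \<rho>)
  have \<rho>d: "\<rho> ^ ?d = real n / m"
  proof -
    have "\<rho> ^ ?d = \<rho> powr real ?d" using \<rho>pos by (simp add: powr_realpow)
    also have "\<dots> = real n / m" using m(1) n by (simp add: \<rho> m_def[symmetric] powr_powr)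
    finally show ?thesis .
  qed
  have finA: "finite A"
  proof (rule finite_subset[OF _ finite_l1_le])
    show "A \<subseteq> {x. l1 x \<le> nat (int n - h)}" using admissible_toppled[OF adm h] by (auto simp: A_def)
  qed
  show ?thesis
    unfolding cluster
  proof (rule cluster_estimate[OF \<eta> \<rho>pos _ _ finA])
    fix x :: "int ^ 'd" assume x: "norm (embed x) \<le> \<eta>\<^sup>2 * (r * \<rho>)"
    have apos: "a > 0" using h by (simp add: a add_pos_pos)
    have "\<eta> * \<rho> \<le> (real n / a) powr (1 / real ?d)"
    proof -
      have "\<eta> = (\<eta> ^ ?d) powr (1 / real ?d)"
        using \<eta> by (simp add: powr_powr flip: powr_realpow)
      then have "\<eta> * \<rho> = (\<eta> ^ ?d) powr (1 / real ?d) * (real n / m) powr (1 / real ?d)"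
        by (simp only: \<rho> m_def)
      also have "\<dots> = (\<eta> ^ ?d * (real n / m)) powr (1 / real ?d)"
        by (simp only: powr_mult)
      also have "\<dots> \<le> (real n / a) powr (1 / real ?d)"
      proof (intro powr_mono2)
        have "\<eta> ^ ?d * a * real n \<le> m * real n" using a(2) by (intro mult_right_mono) (simp_all add: m_def)
        then show "\<eta> ^ ?d * (real n / m) \<le> real n / a" using apos m(1) by (simp add: field_simps)
      qed (use \<eta> m(1) in auto)
      finally show ?thesis .
    qed
    then have "\<eta> * r * (\<eta> * \<rho>) \<le> \<eta> * r * (real n / a) powr (1 / real ?d)"
      using \<eta> radius_pos by (intro mult_left_mono) auto
    then have "norm (embed x) \<le> \<eta> * r * (real n / a) powr (1 / real ?d)"
      using x by (simp add: power2_eq_square mult.commute mult.left_commute)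
    moreover have "\<forall>x. lap (\<lambda>x. real (c * t x)) x \<le> 2 * real ?d * (a - (if x = 0 then real n else 0))"
      using stable_lap[OF enum st h c(2)] by (simp only: a) blast
    moreover have "\<forall>x. real (c * t x) \<ge> 0" by (intro allI of_nat_0_le_iff)
    ultimately have "real (c * t x) > 0"
      by (intro positive[THEN spec, of "\<lambda>x. real (c * t x)", THEN mp, THEN mp, THEN spec, THEN mp])
    then have "c * t x > 0" by (simp only: of_nat_0_less_iff)
    then show "x \<in> A" by (simp add: A_def)
  next
    have "(\<Sum>x\<in>A. - h) \<le> (\<Sum>x\<in>A. ?H x - h)"
    proof (intro sum_mono)
      fix x assume "x \<in> A"
      then have "?H x \<ge> 0" using adm unfolding admissible_def A_def by blast
      then show "- h \<le> ?H x - h" by simp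
    qed
    also have "\<dots> \<le> int n - h" using adm finA unfolding admissible_def by blast
    finally have "int (card A) * (- h) \<le> int n - h" by simp
    then have "real_of_int (int (card A) * (- h)) \<le> real_of_int (int n - h)" by (simp only: of_int_le_iff)
    then have "real (card A) * m \<le> real n + m" by (simp add: m(2))
    then have "real (card A) \<le> (real n + m) / m" using m(1) by (simp add: pos_le_divide_eq)
    \<comment> \<open>The surplus m / n reflects that the origin starts n + m above the background,
      not n; \<open>hn\<close> makes it at most q.\<close>
    also have "\<dots> = real n / m * (1 + m / real n)" using m(1) n by (simp add: field_simps)
    also have "\<dots> \<le> real n / m * (1 + (1 - \<eta> ^ (3 * ?d)))"
      using hn m(1) by (intro mult_left_mono) (simp_all add: m_def[symmetric])
    finally show "real (card A) \<le> \<rho> ^ ?d * (2 - \<eta> ^ (3 * ?d))" by (simp add: \<rho>d)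
  next
    fix x assume "x \<in> V - A" "x \<noteq> 0"
    then have "\<exists>v\<in>units. t (x + v) > 0" by (intro received_imp_neighbour[OF enum]) (auto simp: V_def)
    then show "\<exists>v\<in>units. x + v \<in> A" by (simp add: A_def)
  qed (use L in \<open>auto simp: V_def\<close>)
qed

lemma limsup_estimate:
  fixes e :: "nat \<Rightarrow> int ^ 'd" and D :: "nat \<Rightarrow> int ^ 'd \<Rightarrow> nat"
  assumes enum: "unit_vector_enum e" and D: "\<And>n x. D n x < 2 * CARD('d)"
    and h: "h < 0" and c: "0 < c" "c \<le> 2 * CARD('d)"
    and \<eta>: "0 < \<eta>" "\<eta> < 1"
    and h\<eta>: "\<eta> ^ CARD('d) * (\<bar>real_of_int h\<bar> + 4 * real CARD('d)) \<le> \<bar>real_of_int h\<bar>"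
  shows "limsup (\<lambda>n. emeasure lebesgue
      (sym_diff ((*\<^sub>R) ((real n / real_of_int \<bar>h\<bar>) powr (- 1 / real CARD('d))) `
        particle_cluster c e h n (D n)) (ball (0 :: real ^ 'd) r)))
    \<le> ennreal ((4 * real CARD('d) + 3) * (1 - \<eta> ^ (3 * CARD('d))))"
proof (rule Limsup_bounded)
  let ?d = "CARD('d)"
  define a where "a = \<bar>real_of_int h\<bar> + 4 * real ?d"
  define \<rho> where "\<rho> n = (real n / \<bar>real_of_int h\<bar>) powr (1 / real ?d)" for n :: nat
  have m: "\<bar>real_of_int h\<bar> > 0" using h by simp
  note r = radius_pos
  have "filterlim (\<lambda>n. real n / \<bar>real_of_int h\<bar>) at_top sequentially"
    using m filterlim_real_sequentially
      by (intro filterlim_tendsto_pos_mult_at_top[where f = "\<lambda>_. 1 / \<bar>real_of_int h\<bar>" and c = "1 / \<bar>real_of_int h\<bar>" and g = real, simplified]) auto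
  then have "filterlim \<rho> at_top sequentially"
    unfolding \<rho>_def by (rule filterlim_compose[OF powr_at_top, rotated]) auto
  then have \<rho>: "filterlim (\<lambda>n. r * \<rho> n) at_top sequentially"
    using r by (intro filterlim_tendsto_pos_mult_at_top[OF tendsto_const]) auto
  have gaps: "\<eta>\<^sup>2 - \<eta> ^ 3 > 0" "1 - \<eta>\<^sup>2 > 0"
    using \<eta> by (simp_all add: power_strict_decreasing power_less_one_iff abs_square_less_1)
  have 1: "eventually (\<lambda>n. r * \<rho> n \<ge> sqrt (real ?d) / (\<eta>\<^sup>2 - \<eta> ^ 3)) sequentially"
    using \<rho> by (simp add: filterlim_at_top)
  \<comment> \<open>The 2, where the gap condition has 1, yields the strict inequality demanded by
    \<open>cluster_estimate\<close>.\<close>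
  have 2: "eventually (\<lambda>n. r * \<rho> n \<ge> (2 + sqrt (real ?d)) / (1 - \<eta>\<^sup>2)) sequentially"
    using \<rho> by (simp add: filterlim_at_top)
  have q: "1 - \<eta> ^ (3 * ?d) > 0" using \<eta> by (simp add: power_less_one_iff)
  have 3: "eventually (\<lambda>n :: nat. real n \<ge> \<bar>real_of_int h\<bar> / (1 - \<eta> ^ (3 * ?d))) sequentially"
    using filterlim_real_sequentially by (simp add: filterlim_at_top)
  have 4: "eventually (\<lambda>n :: nat. n > 0) sequentially" by (rule eventually_gt_at_top)
  have "a > 0" using m by (simp add: a_def)
  from 1 2 3 4 eventually_positive_on_ball[OF \<eta> this]
  show "eventually (\<lambda>n. emeasure lebesgue
      (sym_diff ((*\<^sub>R) ((real n / real_of_int \<bar>h\<bar>) powr (- 1 / real ?d)) `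
        particle_cluster c e h n (D n)) (ball (0 :: real ^ 'd) r))
    \<le> ennreal ((4 * real ?d + 3) * (1 - \<eta> ^ (3 * ?d)))) sequentially"
  proof eventually_elim
    case (elim n)
    have "(real n / real_of_int \<bar>h\<bar>) powr (- 1 / real ?d) = 1 / \<rho> n"
      by (simp only: \<rho>_def of_int_abs powr_minus_divide[symmetric] minus_divide_left[symmetric])
    moreover have "emeasure lebesgue (sym_diff ((*\<^sub>R) (1 / \<rho> n) ` particle_cluster c e h n (D n)) (ball (0 :: real ^ 'd) r))
      \<le> ennreal ((4 * real ?d + 3) * (1 - \<eta> ^ (3 * ?d)))"
    proof (rule final_config_estimate[OF enum D h c _ \<eta> \<rho>_def a_def])
      show "\<eta> ^ 3 * (r * \<rho> n) \<le> \<eta>\<^sup>2 * (r * \<rho> n) - sqrt (real ?d)"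
        using elim(1) gaps by (simp add: pos_divide_le_eq algebra_simps)
      have "2 + sqrt (real ?d) \<le> r * \<rho> n * (1 - \<eta>\<^sup>2)" using elim(2) gaps by (simp add: pos_divide_le_eq)
      then show "\<eta>\<^sup>2 * (r * \<rho> n) + 1 + sqrt (real ?d) < r * \<rho> n" by (simp add: algebra_simps)
      show "\<bar>real_of_int h\<bar> / real n \<le> 1 - \<eta> ^ (3 * ?d)"
        using elim(3,4) q by (simp add: field_simps)
    qed (use elim h\<eta> in \<open>auto simp: a_def\<close>)
    ultimately show ?case by (simp only:)
  qed
qed

end

theorem theorem4p7:
  fixes M :: model
    and e :: "nat \<Rightarrow> int ^ 'd::finite"
    and D0 :: "int \<Rightarrow> nat \<Rightarrow> int ^ 'd \<Rightarrow> nat"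
    and r :: real
  assumes "unit_vector_enum e"
    and "\<And>h n x. D0 h n x < 2 * CARD('d)"
    and "emeasure lebesgue (ball (0 :: real ^ 'd) r) = 1"
  shows "((\<lambda>h::int. limsup (\<lambda>n::nat. emeasure lebesgue
            (sym_diff
              ((*\<^sub>R) ((real n / real_of_int \<bar>h\<bar>) powr (- 1 / real CARD('d))) `
                 particle_cluster (model_const M CARD('d)) e h n (D0 h n))
              (ball (0 :: real ^ 'd) r)))) \<longlongrightarrow> 0) at_bot"
proof (rule tendsto_zero_ennreal)
  fix \<delta> :: real assume \<delta>: "\<delta> > 0"
  let ?d = "CARD('d)"
  have c: "0 < model_const M ?d" "model_const M ?d \<le> 2 * ?d"
    by (cases M; simp add: Suc_le_eq)+
  have "((\<lambda>\<eta>. (4 * real ?d + 3) * (1 - \<eta> ^ (3 * ?d))) \<longlongrightarrow> (4 * real ?d + 3) * (1 - 1 ^ (3 * ?d))) (at_left (1 :: real))"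
    by (intro tendsto_intros)
  then have "eventually (\<lambda>\<eta>. (4 * real ?d + 3) * (1 - \<eta> ^ (3 * ?d)) < \<delta>) (at_left (1 :: real))"
    by (rule order_tendstoD) (use \<delta> in simp)
  moreover have "eventually (\<lambda>\<eta>. \<eta> \<in> {0<..<1}) (at_left (1 :: real))"
    by (intro eventually_at_leftI[of 0]) auto
  ultimately have "eventually (\<lambda>\<eta>. (4 * real ?d + 3) * (1 - \<eta> ^ (3 * ?d)) < \<delta> \<and> \<eta> \<in> {0<..<1}) (at_left (1 :: real))"
    by (rule eventually_conj)
  from eventually_happens'[OF trivial_limit_at_left_real this]
  \<comment> \<open>\<eta> is fixed by \<delta> alone; how negative h must be is decided
    afterwards.\<close>
  obtain \<eta> :: real where \<eta>: "0 < \<eta>" "\<eta> < 1" "(4 * real ?d + 3) * (1 - \<eta> ^ (3 * ?d)) < \<delta>"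
    by auto
  have q: "1 - \<eta> ^ ?d > 0" using \<eta> by (simp add: power_less_one_iff)
  \<comment> \<open>For such h, 4d \<le> |h| (1 - \<eta>^d), which makes the background |h| + 4d of
    \<open>stable_lap\<close> at most |h| / \<eta>^d. The extra -1 guarantees h < 0.\<close>
  have "eventually (\<lambda>h :: int. h \<le> - 1 - \<lceil>4 * real ?d / (1 - \<eta> ^ ?d)\<rceil>) at_bot"
    by (rule eventually_le_at_bot)
  then show "eventually (\<lambda>h::int. limsup (\<lambda>n::nat. emeasure lebesgue
            (sym_diff
              ((*\<^sub>R) ((real n / real_of_int \<bar>h\<bar>) powr (- 1 / real ?d)) `
                 particle_cluster (model_const M ?d) e h n (D0 h n))
              (ball (0 :: real ^ 'd) r))) < ennreal \<delta>) at_bot"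
  proof eventually_elim
    case (elim h)
    have "0 \<le> 4 * real ?d / (1 - \<eta> ^ ?d)" using q by simp
    then have "0 \<le> \<lceil>4 * real ?d / (1 - \<eta> ^ ?d)\<rceil>" by linarith
    then have h: "h < 0" using elim by linarith
    have "4 * real ?d / (1 - \<eta> ^ ?d) \<le> \<bar>real_of_int h\<bar>" using elim h by linarith
    then have "4 * real ?d \<le> \<bar>real_of_int h\<bar> * (1 - \<eta> ^ ?d)" using q by (simp only: pos_divide_le_eq)
    moreover have "\<eta> ^ ?d * (4 * real ?d) \<le> 4 * real ?d"
      using \<eta> by (intro mult_left_le_one_le power_le_one) auto
    ultimately have "\<eta> ^ ?d * (\<bar>real_of_int h\<bar> + 4 * real ?d) \<le> \<bar>real_of_int h\<bar>"
      unfolding distrib_left right_diff_distrib mult_1_right mult.commute[of "\<eta> ^ ?d" "\<bar>real_of_int h\<bar>"]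
      by linarith
    then have "limsup (\<lambda>n::nat. emeasure lebesgue
            (sym_diff
              ((*\<^sub>R) ((real n / real_of_int \<bar>h\<bar>) powr (- 1 / real ?d)) `
                 particle_cluster (model_const M ?d) e h n (D0 h n))
              (ball (0 :: real ^ 'd) r))) \<le> ennreal ((4 * real ?d + 3) * (1 - \<eta> ^ (3 * ?d)))"
      by (rule limsup_estimate[OF assms(3,1,2) h c \<eta>(1,2)])
    also have "\<dots> < ennreal \<delta>" using \<eta> \<delta> by (intro ennreal_lessI) auto
    finally show ?case .
  qed
qed

end
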